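(* Let $M$ and $N$ be two quasianalytic weight sequences and put $n_j:=N_j/j!$. (Beurling case) If $\mathcal{O}^0\subsetneq\mathcal{E}^0_{(N)}$, i.e. $\lim_{j\to+\infty}(n_j)^{1/j}=+\infty$, then $\mathcal{F}_{(N)}\setminus j^\infty(\mathcal{E}^0_{\{M\}})$ is $\mathfrak{c}$-algebrable in $\mathcal{F}_{(N)}$ endowed with the Cauchy product (hence $\mathcal{F}_{(N)}\setminus j^\infty(\mathcal{E}^0_{(M)})$ too). (Roumieu case) If $\mathcal{O}^0\subsetneq\mathcal{E}^0_{\{N\}}$, i.e. $\sup_{j\in\mathbb{N}_{>0}}(n_j)^{1/j}=+\infty$, then $\mathcal{F}_{\{N\}}\setminus j^\infty(\mathcal{E}^0_{\{M\}})$ is $\mathfrak{c}$-algebrable in $\mathcal{F}_{\{N\}}$ endowed with the Cauchy product (hence $\mathcal{F}_{\{N\}}\setminus j^\infty(\mathcal{E}^0_{(M)})$ too).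
   Context: $\mathbb{N}=\{0,1,2,\dots\}$; $\mathfrak{c}$ is the cardinality of the continuum. For a sequence $M=(M_j)_{j\in\mathbb{N}}$ of positive reals put $m_j:=M_j/j!$. $M$ is a weight sequence if (I) $1=M_0\le M_1$; (II) $M$ is log-convex, i.e. $M_j^2\le M_{j-1}M_{j+1}$ for all $j\ge1$; (III) $\liminf_{j\to\infty}(m_j)^{1/j}>0$. $M$ is quasianalytic if $\sum_{j\ge1}M_{j-1}/M_j=+\infty$. For $U\subseteq\mathbb{R}$ nonempty open, $\mathcal{E}(U)$ is the space of complex-valued smooth functions on $U$. $\mathcal{E}_{\{M\}}(U)$ (Roumieu type), resp. $\mathcal{E}_{(M)}(U)$ (Beurling type), is the set of $f\in\mathcal{E}(U)$ such that for every compact $K\subseteq U$ and for some $h>0$, resp. for every $h>0$, $\sup_{j\in\mathbb{N},x\in K}\frac{|f^{(j)}(x)|}{h^jM_j}<+\infty$. $\mathcal{E}^0_{\{M\}}$ and $\mathcal{E}^0_{(M)}$ are the spaces of germs at $0$, i.e. $\varinjlim_{k}\mathcal{E}_{\{M\}}((-\frac1k,\frac1k))$ resp. $\varinjlim_k\mathcal{E}_{(M)}((-\frac1k,\frac1k))$. $\mathcal{O}^0$ is the space of germs at $0$ of real analytic functions. $\mathcal{F}_{\{M\}}$, resp. $\mathcal{F}_{(M)}$, is the vector space of formal power series $\mathbf{F}=\sum_{j\ge0}F_jx^j$ with complex coefficients such that for some $h>0$, resp. for every $h>0$, $\sup_{j\in\mathbb{N}}\frac{|F_j|}{h^jm_j}<+\infty$.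 The Borel map is $j^\infty(f)=\sum_{j\ge0}\frac{f^{(j)}(0)}{j!}x^j$. The Cauchy product is $\mathbf{F}\ast\mathbf{G}=\sum_{j\ge0}\big(\sum_{r=0}^jF_rG_{j-r}\big)x^j$; under it $\mathcal{F}_{\{N\}}$ and $\mathcal{F}_{(N)}$ are algebras for every weight sequence $N$. A subset $\mathcal{B}$ of an algebra $\mathcal{A}$ is $\kappa$-algebrable if there is a $\kappa$-generated subalgebra $\mathcal{C}$ of $\mathcal{A}$ (not required to contain a unit) with $\mathcal{C}\subseteq\mathcal{B}\cup\{0\}$; $\kappa$-generated means that $\mathcal{C}$ has a minimal system of generators of cardinality $\kappa$. *)

theory Defs
  imports "HOL-Analysis.Analysis" "HOL-Computational_Algebra.Formal_Power_Series"
    "HOL-Library.Equipollence"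
begin

section \<open>Weight sequences\<close>

definition over_fact :: "(nat \<Rightarrow> real) \<Rightarrow> nat \<Rightarrow> real" where
  "over_fact M j = M j / fact j"

definition weight_sequence :: "(nat \<Rightarrow> real) \<Rightarrow> bool" where
  "weight_sequence M \<longleftrightarrow>
     (\<forall>j. 0 < M j) \<and>
     M 0 = 1 \<and> 1 \<le> M 1 \<and>
     (\<forall>j\<ge>1. (M j)\<^sup>2 \<le> M (j - 1) * M (j + 1)) \<and>
     0 < liminf (\<lambda>j. ereal (root j (over_fact M j)))"

text \<open>The terms are positive, so divergence to infinity is the failure of summability.
  The index is shifted by one.\<close>

definition quasianalytic :: "(nat \<Rightarrow> real) \<Rightarrow> bool" where
  "quasianalytic M \<longleftrightarrow> \<not> summable (\<lambda>j. M j / M (Suc j))"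

section \<open>Ultradifferentiable functions on open subsets of the line\<close>

text \<open>A function on an open set \<open>U\<close> is represented by a total function; its values outside
  \<open>U\<close> are irrelevant, since derivatives are only taken at points of \<open>U\<close>.\<close>

definition nderiv :: "nat \<Rightarrow> (real \<Rightarrow> complex) \<Rightarrow> real \<Rightarrow> complex" where
  "nderiv j = (\<lambda>f x. vector_derivative f (at x)) ^^ j"

definition smooth_functions :: "real set \<Rightarrow> (real \<Rightarrow> complex) set" where
  "smooth_functions U = {f. \<forall>j. \<forall>x\<in>U. nderiv j f differentiable (at x)}"

definition ultradiff_bound :: "(nat \<Rightarrow> real) \<Rightarrow> real set \<Rightarrow> real \<Rightarrow> (real \<Rightarrow> complex) \<Rightarrow> bool" where
  "ultradiff_bound M K h f \<longleftrightarrow>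
     bdd_above ((\<lambda>(j, x). norm (nderiv j f x) / (h ^ j * M j)) ` (UNIV \<times> K))"

definition roumieu_functions :: "(nat \<Rightarrow> real) \<Rightarrow> real set \<Rightarrow> (real \<Rightarrow> complex) set" where
  "roumieu_functions M U =
     {f \<in> smooth_functions U. \<forall>K. compact K \<and> K \<subseteq> U \<longrightarrow> (\<exists>h>0. ultradiff_bound M K h f)}"

definition beurling_functions :: "(nat \<Rightarrow> real) \<Rightarrow> real set \<Rightarrow> (real \<Rightarrow> complex) set" where
  "beurling_functions M U =
     {f \<in> smooth_functions U. \<forall>K. compact K \<and> K \<subseteq> U \<longrightarrow> (\<forall>h>0. ultradiff_bound M K h f)}"

definition real_analytic_functions :: "real set \<Rightarrow> (real \<Rightarrow> complex) set" where
  "real_analytic_functions U =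
     {f. \<forall>x\<in>U. \<exists>r>0. \<exists>a. \<forall>y. \<bar>y - x\<bar> < r \<longrightarrow> (\<lambda>n. a n * of_real (y - x) ^ n) sums f y}"

section \<open>Germs at 0 and the Borel map\<close>

definition germ_eq :: "(real \<Rightarrow> complex) \<Rightarrow> (real \<Rightarrow> complex) \<Rightarrow> bool" where
  "germ_eq f g \<longleftrightarrow> (\<forall>\<^sub>F x in nhds 0. f x = g x)"

lemma equivp_germ_eq: "equivp germ_eq"
proof (rule equivpI)
  show "reflp germ_eq"
    by (auto simp: reflp_def germ_eq_def)
  show "symp germ_eq"
    by (auto simp: symp_def germ_eq_def eq_commute)
  show "transp germ_eq"
    unfolding transp_def germ_eq_def
  proof (intro allI impI)
    fix f g h :: "real \<Rightarrow> complex"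
    assume "\<forall>\<^sub>F x in nhds 0. f x = g x" and "\<forall>\<^sub>F x in nhds 0. g x = h x"
    then show "\<forall>\<^sub>F x in nhds 0. f x = h x"
      by eventually_elim simp
  qed
qed

quotient_type germ = "real \<Rightarrow> complex" / germ_eq
  by (rule equivp_germ_eq)

lift_definition germ_of :: "(real \<Rightarrow> complex) \<Rightarrow> germ" is "\<lambda>f. f" .

text \<open>The inductive limit over \<open>k\<close> of the spaces \<open>X (-1/k, 1/k)\<close> with the restriction maps, as
  a subset of the germs of all functions.\<close>

definition germs_at_0 :: "(real set \<Rightarrow> (real \<Rightarrow> complex) set) \<Rightarrow> germ set" where
  "germs_at_0 X = (\<Union>k\<in>{1::nat..}. germ_of ` X {- (1 / real k)<..<1 / real k})"

definition roumieu_germs :: "(nat \<Rightarrow> real) \<Rightarrow> germ set" where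
  "roumieu_germs M = germs_at_0 (roumieu_functions M)"

definition beurling_germs :: "(nat \<Rightarrow> real) \<Rightarrow> germ set" where
  "beurling_germs M = germs_at_0 (beurling_functions M)"

definition analytic_germs :: "germ set" where
  "analytic_germs = germs_at_0 real_analytic_functions"

lemma nderiv_germ_eq:
  assumes "germ_eq f g"
  shows "germ_eq (nderiv j f) (nderiv j g)"
proof (induction j)
  case 0
  then show ?case using assms by (simp add: nderiv_def)
next
  case (Suc j)
  have "\<forall>\<^sub>F x in nhds 0. \<forall>\<^sub>F y in nhds x. nderiv j f y = nderiv j g y"
    using Suc by (simp add: germ_eq_def eventually_eventually)
  then have "\<forall>\<^sub>F x in nhds 0. vector_derivative (nderiv j f) (at x) =
      vector_derivative (nderiv j g) (at x)"
    by eventually_elim (rule vector_derivative_cong_eq, auto elim: eventually_mono)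
  then show ?case by (simp add: nderiv_def germ_eq_def)
qed

lift_definition borel_map :: "germ \<Rightarrow> complex fps" is
  "\<lambda>f. Abs_fps (\<lambda>j. nderiv j f 0 / fact j)"
proof -
  fix f g :: "real \<Rightarrow> complex"
  assume "germ_eq f g"
  then have "nderiv j f 0 = nderiv j g 0" for j
    using eventually_nhds_x_imp_x[OF nderiv_germ_eq[unfolded germ_eq_def]]
    by (simp add: germ_eq_def)
  then show "Abs_fps (\<lambda>j. nderiv j f 0 / fact j) = Abs_fps (\<lambda>j. nderiv j g 0 / fact j)"
    by simp
qed

section \<open>Weighted spaces of formal power series\<close>

definition series_bound :: "(nat \<Rightarrow> real) \<Rightarrow> real \<Rightarrow> complex fps \<Rightarrow> bool" where
  "series_bound M h F \<longleftrightarrow> bdd_above (range (\<lambda>j. norm (fps_nth F j) / (h ^ j * over_fact M j)))"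

definition roumieu_series :: "(nat \<Rightarrow> real) \<Rightarrow> complex fps set" where
  "roumieu_series M = {F. \<exists>h>0. series_bound M h F}"

definition beurling_series :: "(nat \<Rightarrow> real) \<Rightarrow> complex fps set" where
  "beurling_series M = {F. \<forall>h>0. series_bound M h F}"

section \<open>Algebrability\<close>

text \<open>The product of \<^typ>\<open>complex fps\<close> is the Cauchy product. Subalgebras need not contain 1.\<close>

definition subalgebra :: "complex fps set \<Rightarrow> bool" where
  "subalgebra C \<longleftrightarrow> 0 \<in> C \<and>
     (\<forall>F\<in>C. \<forall>G\<in>C. F + G \<in> C) \<and>
     (\<forall>c. \<forall>F\<in>C. fps_const c * F \<in> C) \<and>
     (\<forall>F\<in>C. \<forall>G\<in>C. F * G \<in> C)"

definition minimal_generators :: "complex fps set \<Rightarrow> complex fps set \<Rightarrow> bool" where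
  "minimal_generators C S \<longleftrightarrow>
     subalgebra hull S = C \<and> (\<forall>T. T \<subset> S \<longrightarrow> subalgebra hull T \<noteq> C)"

text \<open>The cardinal is given by a set \<open>K\<close> of that cardinality; \<open>A\<close> is the ambient algebra.\<close>

definition algebrable :: "'k set \<Rightarrow> complex fps set \<Rightarrow> complex fps set \<Rightarrow> bool" where
  "algebrable K A B \<longleftrightarrow>
     (\<exists>C S. subalgebra C \<and> C \<subseteq> A \<and> C \<subseteq> B \<union> {0} \<and> minimal_generators C S \<and> S \<approx> K)"

end

theory Submission imports Defs "HOL-Complex_Analysis.Complex_Analysis" begin

text \<open>
  If the jet at 0 of a function in the quasianalytic class of \<open>M\<close> has no terms of order strictly
  between \<open>q\<close> and \<open>q'\<close>, then the function minus its Taylor polynomial of degree \<open>q\<close> is flat to order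
  \<open>q'\<close>. Bang's argument shows that it stays small on a fixed interval, provided \<open>q'\<close> is large enough in
  terms of \<open>q\<close> and \<open>M\<close> alone. So the Taylor polynomial is bounded there uniformly in \<open>q\<close>, and its
  leading coefficient is at most exponential in \<open>q\<close>.

  Take generators supported on one superlacunary set of exponents \<open>p k\<close>, with coefficients
  \<open>k ^ p k * s t k\<close> at \<open>p k\<close>. A polynomial of degree \<open>d\<close> in them has no terms strictly between
  \<open>d * p k\<close> and \<open>p (Suc k)\<close>, and its coefficient at \<open>d * p k\<close> is \<open>k ^ (d * p k)\<close> times the value of its
  top homogeneous part at the point \<open>s _ k\<close>. If the \<open>s t\<close>, indexed by sets \<open>t\<close> of naturals, form an
  independent family, this value is one fixed nonzero number for infinitely many \<open>k\<close>, which is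
  incompatible with exponential growth. Since only \<open>n j \<ge> k ^ (2 * j)\<close> at \<open>j = p k\<close> is needed, one
  family of generators serves both the Beurling and the Roumieu case.
\<close>

section \<open>Decay of functions with a flat point\<close>

text \<open>The bound on \<open>g j\<close> is trivial for \<open>j > n\<close> because of \<open>b \<ge> exp (- real (Suc n))\<close>, and it
  is integrated downwards from there: the ratio \<open>W (Suc j) / W j\<close> is at most its value at \<open>n\<close>.\<close>

lemma bang_step:
  fixes g :: "nat \<Rightarrow> real \<Rightarrow> 'a::real_normed_vector"
  assumes W: "\<And>j. 0 < W j" "incseq (\<lambda>j. W (Suc j) / W j)"
    and der: "\<And>j t. t \<in> {0..a} \<Longrightarrow> (g j has_vector_derivative g (Suc j) t) (at t)"
    and bnd: "\<And>j t. t \<in> {0..a} \<Longrightarrow> norm (g j t) \<le> W j"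
    and x: "0 \<le> x" and b: "exp (- real (Suc n)) \<le> b"
    and Q: "\<And>j. norm (g j x) \<le> b * exp (real j) * W j"
    and y: "x \<le> y" "y \<le> a"
  shows "norm (g j y) \<le> b * exp (real j) * W j * exp (exp 1 * (W (Suc n) / W n) * (y - x))"
proof -
  \<comment> \<open>This choice gives \<open>\<phi> (Suc j) \<le> r * \<phi> j\<close> for
    \<open>j \<le> n\<close>, where the right-hand side is the derivative of
    \<open>\<phi> j\<close>. The factor \<open>exp 1\<close> pays for the passage from
    \<open>exp (real j)\<close> to \<open>exp (real (Suc j))\<close>.\<close>
  define r where "r = exp 1 * (W (Suc n) / W n)"
  have r0: "0 < r" using W(1) by (simp add: r_def)
  have b0: "0 < b" using b exp_gt_zero less_le_trans by blast
  define \<phi> where "\<phi> j y = b * exp (real j) * W j * exp (r * (y - x))" for j y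
  have high: "norm (g j y) \<le> \<phi> j y" if "j \<ge> Suc n" "x \<le> y" "y \<le> a" for j y
  proof -
    have "1 = exp (- real (Suc n)) * exp (real (Suc n))" by (simp flip: exp_add)
    also have "\<dots> \<le> b * exp (real j)" using that b b0 by (intro mult_mono) auto
    finally have "1 * 1 \<le> (b * exp (real j)) * exp (r * (y - x))"
      using that r0 b0 by (intro mult_mono) auto
    then have "W j * 1 \<le> W j * ((b * exp (real j)) * exp (r * (y - x)))"
      using W(1)[of j] by (intro mult_left_mono) auto
    then show ?thesis using bnd[of y j] x that by (simp add: \<phi>_def mult_ac)
  qed
  have "\<forall>y. x \<le> y \<and> y \<le> a \<longrightarrow> norm (g j y) \<le> \<phi> j y" for j
  proof (cases "j \<ge> Suc n")
    case True then show ?thesis using high by blast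
  next
    case False
    then have "j \<le> Suc n" by simp
    then show ?thesis
    proof (induction j rule: inc_induct)
      case base then show ?case using high by blast
    next
      case (step j)
      show ?case
      proof (intro allI impI)
        fix y assume y: "x \<le> y \<and> y \<le> a"
        have gx: "norm (g j x) \<le> \<phi> j x" using Q by (simp add: \<phi>_def)
        show "norm (g j y) \<le> \<phi> j y"
        proof (cases "x = y")
          case True then show ?thesis using gx by simp
        next
          case False
          have ratio: "exp (real (Suc j)) * W (Suc j) \<le> exp (real j) * W j * r"
          proof -
            have "W (Suc j) / W j \<le> W (Suc n) / W n"
              using incseqD[OF W(2), of j n] step by simp
            then have "W (Suc j) \<le> W j * (W (Suc n) / W n)"
              using W(1)[of j] by (simp add: field_simps)
            then have "exp (real (Suc j)) * W (Suc j) \<le> exp (real (Suc j)) * (W j * (W (Suc n) / W n))"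
              by (rule mult_left_mono) simp
            then show ?thesis by (simp add: r_def exp_add mult_ac)
          qed
          have "norm (g j y - g j x) \<le> \<phi> j y - \<phi> j x"
          proof (rule differentiable_bound_general[where f' = "g (Suc j)" and \<phi>' = "\<lambda>t. \<phi> j t * r"])
            show "x < y" using y False by simp
            show "continuous_on {x..y} (g j)"
              using der x y
              by (meson atLeastAtMost_iff continuous_at_imp_continuous_on dual_order.trans
                  has_vector_derivative_continuous)
            show "continuous_on {x..y} (\<phi> j)" unfolding \<phi>_def by (intro continuous_intros)
            show "(g j has_vector_derivative g (Suc j) t) (at t)" if "x < t" "t < y" for t
              using der that x y by simp
            show "(\<phi> j has_vector_derivative \<phi> j t * r) (at t)" for t
              unfolding \<phi>_def has_real_derivative_iff_has_vector_derivative[symmetric]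
              by (auto intro!: derivative_eq_intros)
            show "norm (g (Suc j) t) \<le> \<phi> j t * r" if "x < t" "t < y" for t
            proof -
              have "norm (g (Suc j) t) \<le> \<phi> (Suc j) t" using step.IH that y by simp
              also have "\<dots> = (b * exp (r * (t - x))) * (exp (real (Suc j)) * W (Suc j))"
                by (simp add: \<phi>_def)
              also have "\<dots> \<le> (b * exp (r * (t - x))) * (exp (real j) * W j * r)"
                using ratio b0 by (intro mult_left_mono) auto
              finally show ?thesis by (simp add: \<phi>_def mult_ac)
            qed
          qed
          then show ?thesis using gx norm_triangle_sub[of "g j y" "g j x"] by linarith
        qed
      qed
    qed
  qed
  then show ?thesis using y by (simp add: \<phi>_def r_def)
qed

text \<open>Quantitative form of Bang's theorem. At 0 flatness to order \<open>N\<close> yields the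
  factor \<open>exp (- real N)\<close>. Moving right by \<open>W L / (exp 1 * W (Suc L))\<close>
  costs at most one factor \<open>exp 1\<close> by \<open>bang_step\<close> with
  \<open>n = L\<close>, so the bound with \<open>Suc L\<close> becomes the bound with
  \<open>L\<close>. The sum is the total distance that can be covered in this way.\<close>

lemma bang_decay:
  fixes g :: "nat \<Rightarrow> real \<Rightarrow> 'a::real_normed_vector"
  assumes W: "\<And>j. 0 < W j" "incseq (\<lambda>j. W (Suc j) / W j)"
    and der: "\<And>j t. t \<in> {0..a} \<Longrightarrow> (g j has_vector_derivative g (Suc j) t) (at t)"
    and bnd: "\<And>j t. t \<in> {0..a} \<Longrightarrow> norm (g j t) \<le> W j"
    and flat: "\<And>j. j < N \<Longrightarrow> g j 0 = 0"
    and L: "L \<le> N" and x: "0 \<le> x" "x \<le> a" "x \<le> (\<Sum>i=L..<N. W i / (exp 1 * W (Suc i)))"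
  shows "norm (g j x) \<le> exp (- real L) * exp (real j) * W j"
  using L x
proof (induction L arbitrary: x j rule: inc_induct)
  case base
  then have x0: "x = 0" by simp
  show ?case
  proof (cases "j < N")
    case True then show ?thesis using flat x0 W(1)[of j] by (simp add: less_imp_le)
  next
    case False
    \<comment> \<open>For orders not covered by flatness the general bound suffices, as
      \<open>exp (real j - real N) \<ge> 1\<close>.\<close>
    have "norm (g j 0) \<le> W j" using bnd x0 base by simp
    also have "\<dots> \<le> exp (real j - real N) * W j" using False W(1)[of j] by simp
    finally show ?thesis using x0 by (simp add: exp_diff exp_minus field_simps)
  qed
next
  case (step L)
  define S where "S = (\<Sum>i=Suc L..<N. W i / (exp 1 * W (Suc i)))"
  define d where "d = W L / (exp 1 * W (Suc L))"
  \<comment> \<open>The point from which the last step starts. If \<open>x\<close> is already within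
    the distance \<open>S\<close> covered by the indices above \<open>L\<close>, then
    \<open>x' = x\<close> and the last step has length 0.\<close>
  define x' where "x' = min x S"
  have S0: "0 \<le> S" unfolding S_def using W(1) by (intro sum_nonneg) (simp add: less_imp_le)
  have xs: "x \<le> d + S" using step by (simp add: S_def d_def sum.atLeast_Suc_lessThan)
  have x': "0 \<le> x'" "x' \<le> x" "x' \<le> S" "x - x' \<le> d"
    using xs S0 step W(1) by (auto simp: x'_def d_def min_def less_imp_le)
  have Q: "norm (g j x') \<le> exp (- real (Suc L)) * exp (real j) * W j" for j
    using x' step by (intro step.IH) (auto simp: S_def)
  have "norm (g j x) \<le> exp (- real (Suc L)) * exp (real j) * W j *
      exp (exp 1 * (W (Suc L) / W L) * (x - x'))"
    by (rule bang_step[OF W der bnd x'(1) order_refl Q x'(2)]) (use step in auto)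
  also have "\<dots> \<le> exp (- real (Suc L)) * exp (real j) * W j * exp 1"
  proof -
    have "exp 1 * (W (Suc L) / W L) * (x - x') \<le> exp 1 * (W (Suc L) / W L) * d"
      using x' W(1)[of L] W(1)[of "Suc L"] by (intro mult_left_mono) auto
    also have "\<dots> = 1" using W(1)[of L] W(1)[of "Suc L"] by (simp add: d_def field_simps)
    finally show ?thesis using W(1)[of j] by (intro mult_left_mono) auto
  qed
  also have "\<dots> = exp (- real L) * exp (real j) * W j"
    by (simp add: mult_ac flip: exp_add)
  finally show ?case .
qed

section \<open>Finite differences and the leading coefficient of a polynomial\<close>

lemma power_minus_one_fps: "fps_const ((- 1) ^ n) = (- 1 :: 'a::comm_ring_1 fps) ^ n"
  by (induction n) (simp_all flip: fps_const_mult fps_const_neg)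

text \<open>Compare the coefficients of \<open>(exp X - 1) ^ n\<close>.\<close>

lemma alternating_binomial_power_sum:
  fixes m n :: nat
  assumes "m \<le> n"
  shows "(\<Sum>i\<le>n. of_nat (n choose i) * (-1) ^ (n - i) * of_nat i ^ m) =
    (if m = n then fact n else 0 :: complex)"
proof -
  define a :: "complex fps" where "a = fps_exp 1 - 1"
  have a0: "fps_nth a 0 = 0" and a1: "fps_nth a 1 = 1" by (simp_all add: a_def)
  have "a ^ n = (\<Sum>i\<le>n. of_nat (n choose i) * fps_exp 1 ^ i * (-1) ^ (n - i))"
    unfolding a_def diff_conv_add_uminus by (rule binomial_ring)
  also have "\<dots> = (\<Sum>i\<le>n. fps_const (of_nat (n choose i) * (-1) ^ (n - i)) * fps_exp (of_nat i))"
    by (intro sum.cong refl) (simp add: fps_exp_power_mult fps_of_nat mult_ac power_minus_one_fps flip: fps_const_mult)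
  finally have "fps_nth (a ^ n) m = (\<Sum>i\<le>n. of_nat (n choose i) * (-1) ^ (n - i) * (of_nat i ^ m / fact m))"
    by (simp add: fps_sum_nth)
  also have "\<dots> = (\<Sum>i\<le>n. of_nat (n choose i) * (-1) ^ (n - i) * of_nat i ^ m) / fact m"
    by (simp add: sum_divide_distrib)
  finally have *: "(\<Sum>i\<le>n. of_nat (n choose i) * (-1) ^ (n - i) * of_nat i ^ m) = fact m * fps_nth (a ^ n) m"
    by simp
  \<comment> \<open>The series \<open>a\<close> begins with \<open>X\<close>, so
    \<open>a ^ n\<close> has no terms of order below \<open>n\<close> and coefficient 1 at
    \<open>n\<close>.\<close>
  show ?thesis
    using startsby_zero_power_prefix[OF a0, of n] startsby_zero_power_nth_same[OF a0, of n] a1 assms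
    by (auto simp: *)
qed

text \<open>A single term of the exponential series at \<open>n\<close> is at most the whole
  sum.\<close>

lemma power_le_exp_mult_fact: "real n ^ n \<le> exp (real n) * fact n"
proof -
  have "(\<Sum>i\<in>{n}. real n ^ i / fact i) \<le> (\<Sum>i. real n ^ i / fact i)"
    using summable_exp[of "real n"] by (intro sum_le_suminf) (auto simp: field_simps)
  then show ?thesis by (simp add: exp_def field_simps)
qed

text \<open>Take the \<open>q\<close>-th finite difference with step \<open>a / q\<close>.\<close>

lemma leading_coefficient_bound:
  fixes c :: "nat \<Rightarrow> complex"
  assumes a: "0 < a" and bnd: "\<And>x. 0 \<le> x \<Longrightarrow> x \<le> a \<Longrightarrow> norm (\<Sum>i\<le>q. c i * of_real x ^ i) \<le> B"
  shows "norm (c q) \<le> B * (2 * exp 1 / a) ^ q"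
proof (cases "q = 0")
  case True then show ?thesis using bnd[of a] a by simp
next
  case False
  define h where "h = a / real q"
  have h: "0 < h" "h * real q = a" using False a by (simp_all add: h_def)
  define w :: "nat \<Rightarrow> complex" where "w k = of_nat (q choose k) * (-1) ^ (q - k)" for k
  define T where "T x = (\<Sum>i\<le>q. c i * of_real x ^ i)" for x :: real
  have "(\<Sum>k\<le>q. w k * T (h * real k)) = (\<Sum>k\<le>q. \<Sum>i\<le>q. c i * of_real h ^ i * (w k * of_nat k ^ i))"
    by (simp add: T_def sum_distrib_left power_mult_distrib mult_ac)
  also have "\<dots> = (\<Sum>i\<le>q. c i * of_real h ^ i * (\<Sum>k\<le>q. w k * of_nat k ^ i))"
    by (subst sum.swap) (simp add: sum_distrib_left)
  also have "\<dots> = (\<Sum>i\<le>q. if i = q then c q * of_real h ^ q * fact q else 0)"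
    by (intro sum.cong refl) (simp add: w_def alternating_binomial_power_sum)
  also have "\<dots> = c q * of_real h ^ q * fact q" by simp
  finally have eq: "c q * of_real h ^ q * fact q = (\<Sum>k\<le>q. w k * T (h * real k))" ..
  have "norm (c q) * h ^ q * fact q = norm (c q * of_real h ^ q * fact q)"
    using h by (simp add: norm_mult norm_power)
  also have "\<dots> \<le> (\<Sum>k\<le>q. norm (w k * T (h * real k)))" unfolding eq by (rule norm_sum)
  also have "\<dots> \<le> (\<Sum>k\<le>q. real (q choose k) * B)"
  proof (rule sum_mono)
    fix k assume "k \<in> {..q}"
    then have "h * real k \<le> a" using h by (metis atMost_iff mult_left_mono of_nat_le_iff less_imp_le)
    then have "norm (T (h * real k)) \<le> B" using h unfolding T_def by (intro bnd) auto
    then show "norm (w k * T (h * real k)) \<le> real (q choose k) * B"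
      by (simp add: w_def norm_mult norm_power mult_left_mono)
  qed
  also have "\<dots> = 2 ^ q * B"
    by (simp flip: sum_distrib_right of_nat_sum add: choose_row_sum)
  finally have 1: "norm (c q) * h ^ q * fact q \<le> 2 ^ q * B" .
  \<comment> \<open>The step width contributes \<open>q ^ q\<close> and the finite difference
    \<open>fact q\<close>. Their quotient is at most \<open>exp (real q)\<close>, so the final loss
    stays exponential in \<open>q\<close>.\<close>
  have "norm (c q) * a ^ q = norm (c q) * h ^ q * real q ^ q"
    by (simp add: h(2)[symmetric] power_mult_distrib)
  also have "\<dots> \<le> norm (c q) * h ^ q * (exp (real q) * fact q)"
    using h by (intro mult_left_mono power_le_exp_mult_fact) auto
  also have "\<dots> = exp (real q) * (norm (c q) * h ^ q * fact q)" by simp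
  also have "\<dots> \<le> exp (real q) * (2 ^ q * B)" using 1 by simp
  also have "exp (real q) = exp 1 ^ q" by (simp flip: exp_of_nat_mult)
  finally show ?thesis using a by (simp add: field_simps power_mult_distrib power_divide)
qed

section \<open>Weight sequences and jets with gaps\<close>

lemma weight_sequence_pos: "weight_sequence M \<Longrightarrow> 0 < M j"
  by (simp add: weight_sequence_def)

lemma weight_sequence_0: "weight_sequence M \<Longrightarrow> M 0 = 1"
  by (simp add: weight_sequence_def)

lemma weight_sequence_ratio_incseq:
  assumes "weight_sequence M"
  shows "incseq (\<lambda>j. M (Suc j) / M j)"
proof (rule incseq_SucI)
  fix j
  have "(M (Suc j))\<^sup>2 \<le> M j * M (Suc (Suc j))"
    using assms unfolding weight_sequence_def by (metis One_nat_def Suc_eq_plus1 diff_Suc_1 le_add1 plus_1_eq_Suc)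
  then show "M (Suc j) / M j \<le> M (Suc (Suc j)) / M (Suc j)"
    using weight_sequence_pos[OF assms] by (simp add: field_simps power2_eq_square)
qed

lemma weight_sequence_incseq:
  assumes "weight_sequence M"
  shows "incseq M"
proof (rule incseq_SucI)
  fix j
  have "1 \<le> M (Suc 0) / M 0" using assms by (simp add: weight_sequence_def)
  also have "\<dots> \<le> M (Suc j) / M j" using incseqD[OF weight_sequence_ratio_incseq[OF assms], of 0 j] by simp
  finally show "M j \<le> M (Suc j)" using weight_sequence_pos[OF assms, of j] by simp
qed

lemma weight_sequence_ge_1:
  assumes "weight_sequence M"
  shows "1 \<le> M j"
  using incseqD[OF weight_sequence_incseq[OF assms], of 0 j] weight_sequence_0[OF assms] by simp

text \<open>Both \<open>M i\<close> and \<open>M (i + j) / M j\<close> are products of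
  \<open>i\<close> consecutive ratios \<open>M (Suc k) / M k\<close>; the second product sits
  further along an increasing sequence.\<close>

lemma weight_sequence_mult_le:
  assumes "weight_sequence M"
  shows "M i * M j \<le> M (i + j)"
proof (induction i)
  case 0 then show ?case using weight_sequence_0[OF assms] by simp
next
  case (Suc i)
  note pos = weight_sequence_pos[OF assms]
  have "M (Suc i) * M j = (M (Suc i) / M i) * (M i * M j)" using pos[of i] by simp
  also have "\<dots> \<le> (M (Suc (i + j)) / M (i + j)) * M (i + j)"
    using Suc pos incseqD[OF weight_sequence_ratio_incseq[OF assms], of i "i + j"]
    by (intro mult_mono) (auto simp: less_imp_le)
  also have "\<dots> = M (Suc i + j)" using pos[of "i + j"] by simp
  finally show ?case .
qed

text \<open>On a logarithmic scale \<open>M\<close> is convex, so it lies above the line through its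
  points at \<open>p\<close> and \<open>Suc p\<close>. The slope becomes the frequency of an
  exponential in the construction of a nonanalytic function.\<close>

lemma weight_sequence_tangent:
  assumes "weight_sequence M"
  shows "M p * (M (Suc p) / M p) ^ j \<le> M j * (M (Suc p) / M p) ^ p"
proof -
  note pos = weight_sequence_pos[OF assms]
  define \<mu> where "\<mu> i = M (Suc i) / M i" for i
  have \<mu>0: "0 < \<mu> i" for i using pos by (simp add: \<mu>_def)
  have inc: "\<mu> i \<le> \<mu> k" if "i \<le> k" for i k
    using incseqD[OF weight_sequence_ratio_incseq[OF assms] that] by (simp add: \<mu>_def)
  have M_Suc: "M (Suc i) = \<mu> i * M i" for i using pos[of i] by (simp add: \<mu>_def)
  have "M p * \<mu> p ^ j \<le> M j * \<mu> p ^ p"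
  proof (cases "p \<le> j")
    case True
    then show ?thesis
    proof (induction j rule: dec_induct)
      case (step n)
      have "M p * \<mu> p ^ Suc n = \<mu> p * (M p * \<mu> p ^ n)" by simp
      also have "\<dots> \<le> \<mu> n * (M n * \<mu> p ^ p)"
        by (intro mult_mono[OF inc step.IH]) (use step \<mu>0 pos in \<open>auto simp: less_imp_le\<close>)
      finally show ?case by (simp add: M_Suc mult_ac)
    qed simp
  next
    case False
    then have "j \<le> p" by simp
    then show ?thesis
    proof (induction j rule: inc_induct)
      case (step n)
      have "\<mu> p * (M p * \<mu> p ^ n) = M p * \<mu> p ^ Suc n" by simp
      also have "\<dots> \<le> M (Suc n) * \<mu> p ^ p" by (rule step.IH)
      also have "\<dots> = \<mu> n * (M n * \<mu> p ^ p)" by (simp add: M_Suc)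
      also have "\<dots> \<le> \<mu> p * (M n * \<mu> p ^ p)"
        using inc[of n p] step \<mu>0 pos by (intro mult_right_mono) (auto simp: less_imp_le)
      finally show ?case using \<mu>0[of p] by simp
    qed simp
  qed
  then show ?thesis by (simp add: \<mu>_def)
qed

lemma sum_inverse_fact_le: "(\<Sum>i<n. 1 / fact i) \<le> (3::real)"
proof -
  have "(\<Sum>i<n. 1 / fact i) \<le> (\<Sum>i. 1 / fact i :: real)"
    using summable_exp[of "1::real"] by (intro sum_le_suminf) (auto simp: field_simps)
  also have "\<dots> = exp 1" by (simp add: exp_def field_simps)
  also have "\<dots> \<le> 3" by (rule exp_le)
  finally show ?thesis .
qed

text \<open>The two conditions on \<open>L\<close> serve \<open>bang_decay\<close>, applied to
  \<open>f 0\<close> minus its Taylor polynomial of degree \<open>q\<close>: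
  \<open>exp (- real L)\<close> must outweigh the growth of the constant caused by the subtraction,
  and the indices from \<open>L\<close> to \<open>N\<close> must cover a distance of at least 1. The
  Taylor polynomial is then bounded by \<open>2 * C\<close> on \<open>{0..a}\<close>, and
  \<open>leading_coefficient_bound\<close> applies.\<close>

lemma gap_coefficient_bound:
  fixes f :: "nat \<Rightarrow> real \<Rightarrow> complex"
  assumes M: "weight_sequence M"
    and der: "\<And>j t. t \<in> {0..a} \<Longrightarrow> (f j has_vector_derivative f (Suc j) t) (at t)"
    and bnd: "\<And>j t. t \<in> {0..a} \<Longrightarrow> norm (f j t) \<le> C * h ^ j * M j"
    and C: "0 < C" and h: "1 \<le> h" and a: "0 < a" "a \<le> 1"
    and gap: "\<And>i. q < i \<Longrightarrow> i < N \<Longrightarrow> f i 0 = 0"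
    and L: "1 + 3 * h ^ q * M q \<le> exp (real L)" "3 * h \<le> (\<Sum>i=L..<N. M i / M (Suc i))"
  shows "norm (f q 0 / fact q) \<le> 2 * C * (2 * exp 1 / a) ^ q"
proof (rule leading_coefficient_bound[OF a(1), where c = "\<lambda>i. f i 0 / fact i"])
  note pos = weight_sequence_pos[OF M]
  fix x :: real assume x: "0 \<le> x" "x \<le> a"
  \<comment> \<open>\<open>T j\<close> is the \<open>j\<close>-th derivative of the Taylor
    polynomial \<open>T 0\<close>; for \<open>j > q\<close> truncated subtraction makes the sum
    empty.\<close>
  define T where "T j t = (\<Sum>i<Suc q - j. (t ^ i / fact i) *\<^sub>R f (i + j) 0)" for j and t :: real
  define g where "g j t = f j t - T j t" for j t
  \<comment> \<open>The summand 1 accounts for \<open>f\<close>, the other for the Taylor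
    polynomial, with 3 as a bound for the sum of all \<open>1 / fact i\<close>. The bound on
    \<open>T j\<close> does not grow with \<open>j\<close> and fits below a multiple of
    \<open>h ^ j * M j\<close> because that product is at least 1.\<close>
  define D where "D = 1 + 3 * h ^ q * M q"
  define W where "W j = C * D * (h ^ j * M j)" for j
  have D1: "1 \<le> D" using h pos[of q] by (simp add: D_def)
  have Wpos: "0 < W j" for j using C D1 h pos by (simp add: W_def)
  have "incseq (\<lambda>j. h * (M (Suc j) / M j))"
    unfolding incseq_def
    using incseqD[OF weight_sequence_ratio_incseq[OF M]] h by (intro allI impI mult_left_mono) auto
  moreover have ratio: "W (Suc j) / W j = h * (M (Suc j) / M j)" for j
    using C D1 h by (simp add: W_def)
  ultimately have Winc: "incseq (\<lambda>j. W (Suc j) / W j)" by simp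
  have derT: "(T j has_vector_derivative T (Suc j) t) (at t)" for j t
  proof (cases "Suc q - j")
    case 0 then show ?thesis by (simp add: T_def[abs_def])
  next
    case (Suc m)
    have T: "T j = (\<lambda>t. f j 0 + (\<Sum>i<m. (t ^ Suc i / fact (Suc i)) *\<^sub>R f (Suc i + j) 0))"
      unfolding T_def[abs_def] Suc sum.lessThan_Suc_shift by simp
    have "Suc q - Suc j = m" using Suc by simp
    then have T': "T (Suc j) t = (\<Sum>i<m. (t ^ i / fact i) *\<^sub>R f (Suc i + j) 0)" by (simp add: T_def)
    have "((\<lambda>t. t ^ Suc i / fact (Suc i)) has_real_derivative t ^ i / fact i) (at t)" for i
      using DERIV_cdivide[OF DERIV_pow[of "Suc i" t], of "fact (Suc i)"] by (simp del: of_nat_Suc)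
    then have "((\<lambda>t. (t ^ Suc i / fact (Suc i)) *\<^sub>R f (Suc i + j) 0) has_vector_derivative
        (t ^ i / fact i) *\<^sub>R f (Suc i + j) 0) (at t)" for i
      by (rule has_vector_derivative_eq_rhs[OF has_vector_derivative_scaleR[OF _ has_vector_derivative_const]]) simp
    then have "((\<lambda>t. \<Sum>i<m. (t ^ Suc i / fact (Suc i)) *\<^sub>R f (Suc i + j) 0) has_vector_derivative
        (\<Sum>i<m. (t ^ i / fact i) *\<^sub>R f (Suc i + j) 0)) (at t)"
      by (intro has_vector_derivative_sum)
    from has_vector_derivative_add[OF has_vector_derivative_const this]
    show ?thesis unfolding T T' by simp
  qed
  have boundT: "norm (T j t) \<le> (D - 1) * (C * (h ^ j * M j))" if t: "t \<in> {0..a}" for j t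
  proof -
    have "norm (T j t) \<le> (\<Sum>i<Suc q - j. norm ((t ^ i / fact i) *\<^sub>R f (i + j) 0))"
      unfolding T_def by (rule norm_sum)
    also have "\<dots> \<le> (\<Sum>i<Suc q - j. (1 / fact i) * (C * h ^ q * M q))"
    proof (rule sum_mono)
      fix i assume "i \<in> {..<Suc q - j}"
      then have i: "i + j \<le> q" by auto
      have "norm (f (i + j) 0) \<le> C * h ^ (i + j) * M (i + j)" using bnd a by simp
      also have "\<dots> \<le> C * h ^ q * M q"
        using i C h pos incseqD[OF weight_sequence_incseq[OF M] i]
        by (intro mult_mono power_increasing) (auto simp: less_imp_le)
      finally have "norm (f (i + j) 0) \<le> C * h ^ q * M q" .
      moreover have "\<bar>t ^ i / fact i\<bar> \<le> 1 / fact i"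
        using t a by (simp add: abs_mult power_abs divide_right_mono power_le_one)
      ultimately show "norm ((t ^ i / fact i) *\<^sub>R f (i + j) 0) \<le> (1 / fact i) * (C * h ^ q * M q)"
        unfolding norm_scaleR by (intro mult_mono) auto
    qed
    also have "\<dots> \<le> 3 * (C * h ^ q * M q)"
      unfolding sum_distrib_right[symmetric]
      using C h pos[of q] by (intro mult_right_mono sum_inverse_fact_le) auto
    also have "\<dots> = (D - 1) * C * 1" by (simp add: D_def)
    also have "\<dots> \<le> (D - 1) * C * (h ^ j * M j)"
      using D1 C h weight_sequence_ge_1[OF M, of j] mult_mono[of 1 "h ^ j" 1 "M j"]
      by (intro mult_left_mono) auto
    finally show ?thesis by simp
  qed
  have "norm (g 0 x) \<le> exp (- real L) * exp (real 0) * W 0"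
  proof (rule bang_decay[OF Wpos Winc])
    show "(g j has_vector_derivative g (Suc j) t) (at t)" if "t \<in> {0..a}" for j t
      unfolding g_def[abs_def] by (intro has_vector_derivative_diff der derT that)
    show "norm (g j t) \<le> W j" if "t \<in> {0..a}" for j t
      using norm_triangle_ineq4[of "f j t" "T j t"] bnd[OF that, of j] boundT[OF that, of j]
      by (simp add: g_def W_def algebra_simps)
    show "g j 0 = 0" if "j < N" for j
    proof (cases "j \<le> q")
      case True
      have "T j 0 = f j 0" unfolding T_def Suc_diff_le[OF True] sum.lessThan_Suc_shift by simp
      then show ?thesis by (simp add: g_def)
    next
      case False then show ?thesis using gap that by (simp add: g_def T_def)
    qed
    show "L \<le> N" using L(2) h by (cases "L \<le> N") auto
    show "0 \<le> x" "x \<le> a" using x by auto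
    \<comment> \<open>The ratios of \<open>W\<close> are \<open>h\<close> times those of
      \<open>M\<close>, and the 3 in the assumption on the sum majorizes
      \<open>exp 1\<close>.\<close>
    have "x \<le> 1" using x a by simp
    also have "1 \<le> (\<Sum>i=L..<N. M i / M (Suc i)) / (3 * h)" using L(2) h by simp
    also have "\<dots> \<le> (\<Sum>i=L..<N. M i / M (Suc i)) / (exp 1 * h)"
      using exp_le h L(2) by (intro divide_left_mono mult_right_mono) auto
    also have "\<dots> = (\<Sum>i=L..<N. W i / (exp 1 * W (Suc i)))"
      unfolding sum_divide_distrib
    proof (intro sum.cong refl)
      fix i
      have "W i / (exp 1 * W (Suc i)) = 1 / (exp 1 * (W (Suc i) / W i))" by simp
      also have "\<dots> = M i / M (Suc i) / (exp 1 * h)" unfolding ratio by simp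
      finally show "M i / M (Suc i) / (exp 1 * h) = W i / (exp 1 * W (Suc i))" by simp
    qed
    finally show "x \<le> (\<Sum>i=L..<N. W i / (exp 1 * W (Suc i)))" .
  qed
  \<comment> \<open>Here \<open>W 0 = C * D\<close>, and the first condition on \<open>L\<close>
    says exactly that \<open>exp (real L)\<close> absorbs \<open>D\<close>.\<close>
  also have "\<dots> = D / exp (real L) * C"
    by (simp add: W_def weight_sequence_0[OF M] exp_minus field_simps)
  also have "\<dots> \<le> 1 * C" using L(1) C by (intro mult_right_mono) (auto simp: D_def)
  finally have "norm (g 0 x) \<le> C" by simp
  moreover have "norm (f 0 x) \<le> C" using bnd[of x 0] x weight_sequence_0[OF M] by simp
  moreover have "T 0 x = f 0 x - g 0 x" by (simp add: g_def)
  moreover have "T 0 x = (\<Sum>i\<le>q. f i 0 / fact i * of_real x ^ i)"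
    unfolding T_def by (intro sum.cong) (auto simp: scaleR_conv_of_real)
  ultimately show "norm (\<Sum>i\<le>q. f i 0 / fact i * of_real x ^ i) \<le> 2 * C"
    using norm_triangle_ineq4[of "f 0 x" "g 0 x"] by simp
qed

section \<open>Polynomials in lacunary series\<close>

text \<open>The index \<open>k\<close> codes a length \<open>l\<close> and a finite table that prescribes the value of \<open>s t k\<close> from
  \<open>t \<inter> {..<l}\<close>; distinct sets are told apart by large \<open>l\<close>.\<close>

lemma independent_family:
  obtains s :: "nat set \<Rightarrow> nat \<Rightarrow> nat"
  where "\<And>t k. s t k \<le> k"
    and "\<And>X v K. finite X \<Longrightarrow> \<exists>k\<ge>K. \<forall>t\<in>X. s t k = v t"
proof -
  define key :: "nat set \<Rightarrow> nat \<Rightarrow> bool list" where "key t l = map (\<lambda>i. i \<in> t) [0..<l]" for t l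
  \<comment> \<open>Truncation by \<open>min k\<close> ensures \<open>s t k \<le> k\<close>; a key
    missing from the table receives the value 0.\<close>
  define s :: "nat set \<Rightarrow> nat \<Rightarrow> nat" where
    "s t k = (case from_nat k :: nat \<times> (bool list \<times> nat) list of
       (l, xs) \<Rightarrow> min k (case map_of xs (key t l) of None \<Rightarrow> 0 | Some v \<Rightarrow> v))" for t k
  have "s t k \<le> k" for t k by (simp add: s_def split: prod.splits)
  moreover have "\<exists>k\<ge>K. \<forall>t\<in>X. s t k = v t" if X: "finite X" for X K and v :: "nat set \<Rightarrow> nat"
  proof -
    define d where "d p = (SOME i. (i \<in> fst p) \<noteq> (i \<in> snd p))" for p :: "nat set \<times> nat set"
    have d: "(d (t, u) \<in> t) \<noteq> (d (t, u) \<in> u)" if "t \<noteq> u" for t u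
    proof -
      have "\<exists>i. (i \<in> t) \<noteq> (i \<in> u)" using that by blast
      then show ?thesis unfolding d_def fst_conv snd_conv by (rule someI_ex)
    qed
    \<comment> \<open>Beyond every chosen point of difference \<open>d (t, u)\<close>, so that keys
      of length at least \<open>l0\<close> separate the members of \<open>X\<close>.\<close>
    define l0 where "l0 = Suc (Max (insert 0 (d ` (X \<times> X))))"
    have inj: "inj_on (\<lambda>t. key t l) X" if "l \<ge> l0" for l
    proof (rule inj_onI, rule ccontr)
      fix t u assume tu: "t \<in> X" "u \<in> X" "key t l = key u l" "t \<noteq> u"
      have "d (t, u) \<le> Max (insert 0 (d ` (X \<times> X)))" using tu X by (intro Max_ge) auto
      then have "d (t, u) < l" using that by (simp add: l0_def)
      then have "key t l ! d (t, u) = (d (t, u) \<in> t)" "key u l ! d (t, u) = (d (t, u) \<in> u)"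
        by (simp_all add: key_def)
      then show False using d[OF tu(4)] tu(3) by simp
    qed
    obtain Xs where Xs: "set Xs = X" "distinct Xs" using finite_distinct_list[OF X] by blast
    define xs where "xs l = map (\<lambda>t. (key t l, v t)) Xs" for l
    \<comment> \<open>A code that also exceeds all prescribed values is not affected by the
      truncation \<open>min k\<close>.\<close>
    define K' where "K' = max K (Max (insert 0 (v ` X)))"
    \<comment> \<open>The same table can be coded with every length \<open>l \<ge> l0\<close>; these
      codes are distinct, so some of them are as large as desired.\<close>
    have "infinite ((\<lambda>l. to_nat (l, xs l)) ` {l0..})"
    proof
      assume "finite ((\<lambda>l. to_nat (l, xs l)) ` {l0..})"
      moreover have "inj_on (\<lambda>l. to_nat (l, xs l)) {l0..}" by (auto simp: inj_on_def)
      ultimately show False using finite_imageD infinite_Ici by blast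
    qed
    then obtain l where l: "l \<ge> l0" "to_nat (l, xs l) \<ge> K'"
      unfolding infinite_nat_iff_unbounded_le by blast
    have "s t (to_nat (l, xs l)) = v t" if t: "t \<in> X" for t
    proof -
      have "distinct (map fst (xs l))"
        using inj[OF l(1)] Xs by (simp add: xs_def distinct_map o_def)
      moreover have "(key t l, v t) \<in> set (xs l)" using t Xs by (simp add: xs_def)
      ultimately have "map_of (xs l) (key t l) = Some (v t)" by simp
      moreover have "v t \<le> to_nat (l, xs l)"
        using Max_ge[of "insert 0 (v ` X)" "v t"] t X l(2) by (auto simp: K'_def)
      ultimately show ?thesis by (simp add: s_def)
    qed
    moreover have "to_nat (l, xs l) \<ge> K" using l(2) by (simp add: K'_def)
    ultimately show ?thesis by blast
  qed
  ultimately show thesis by (rule that)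
qed

section \<open>Kronecker substitution\<close>

text \<open>Digits in base \<open>W\<close>: the new element receives a weight larger than any
  weighted sum of at most \<open>d\<close> old elements. Its multiplicity is then the quotient by
  \<open>W\<close> and the old part of the sum is the remainder.\<close>

lemma separating_weights:
  assumes "finite T"
  shows "\<exists>w :: 'i \<Rightarrow> nat. \<forall>m m'. set_mset m \<subseteq> T \<and> size m \<le> d \<and> set_mset m' \<subseteq> T \<and> size m' \<le> d \<and>
    (\<Sum>t\<in>#m. w t) = (\<Sum>t\<in>#m'. w t) \<longrightarrow> m = m'"
  using assms
proof (induction T)
  case empty then show ?case by auto
next
  case (insert t T)
  then obtain w :: "'i \<Rightarrow> nat" where w: "\<And>m m'. \<lbrakk>set_mset m \<subseteq> T; size m \<le> d; set_mset m' \<subseteq> T; size m' \<le> d;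
    (\<Sum>t\<in>#m. w t) = (\<Sum>t\<in>#m'. w t)\<rbrakk> \<Longrightarrow> m = m'" by blast
  define W where "W = Suc (d * Max (insert 0 (w ` T)))"
  define w' where "w' = w(t := W)"
  have sumW: "(\<Sum>t\<in>#m. w t) < W" if "set_mset m \<subseteq> T" "size m \<le> d" for m
  proof -
    have "(\<Sum>t\<in>#m. w t) \<le> (\<Sum>t\<in>#m. Max (insert 0 (w ` T)))"
      using that insert by (intro sum_mset_mono Max_ge) auto
    also have "\<dots> = size m * Max (insert 0 (w ` T))" by simp
    also have "\<dots> \<le> d * Max (insert 0 (w ` T))" using that by simp
    finally show ?thesis by (simp add: W_def)
  qed
  define r where "r m = filter_mset (\<lambda>u. u \<noteq> t) m" for m
  have dec: "m = replicate_mset (count m t) t + r m" for m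
    using multiset_partition[of m "\<lambda>u. u = t"] by (simp add: r_def filter_eq_replicate_mset)
  have rT: "set_mset (r m) \<subseteq> T" "size (r m) \<le> d" if "set_mset m \<subseteq> insert t T" "size m \<le> d" for m
    using that order_trans[OF size_filter_mset_lesseq[of "\<lambda>u. u \<noteq> t" m]] by (auto simp: r_def)
  have sum': "(\<Sum>u\<in>#m. w' u) = count m t * W + (\<Sum>u\<in>#r m. w u)" for m
  proof -
    have "(\<Sum>u\<in>#m. w' u) = (\<Sum>u\<in>#replicate_mset (count m t) t. w' u) + (\<Sum>u\<in>#r m. w' u)"
      by (subst dec[of m]) simp
    also have "image_mset w' (r m) = image_mset w (r m)"
      by (intro image_mset_cong) (auto simp: r_def w'_def)
    finally show ?thesis by (simp add: w'_def)
  qed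
  have "m = m'" if m: "set_mset m \<subseteq> insert t T" "size m \<le> d" "set_mset m' \<subseteq> insert t T" "size m' \<le> d"
    and eq: "(\<Sum>t\<in>#m. w' t) = (\<Sum>t\<in>#m'. w' t)" for m m'
  proof -
    have lt: "(\<Sum>u\<in>#r m. w u) < W" "(\<Sum>u\<in>#r m'. w u) < W" using sumW rT m by auto
    have e: "count m t * W + (\<Sum>u\<in>#r m. w u) = count m' t * W + (\<Sum>u\<in>#r m'. w u)"
      using eq unfolding sum' .
    have "count m t = count m' t" using arg_cong[OF e, of "\<lambda>x. x div W"] lt by simp
    moreover have "(\<Sum>u\<in>#r m. w u) = (\<Sum>u\<in>#r m'. w u)" using arg_cong[OF e, of "\<lambda>x. x mod W"] lt by simp
    then have "r m = r m'" using w rT m by blast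
    ultimately show ?thesis using dec[of m] dec[of m'] by simp
  qed
  then show ?case by blast
qed

text \<open>Kronecker substitution: \<open>v t = x ^ w t\<close> turns distinct monomials into distinct powers of \<open>x\<close>.\<close>

lemma nonvanishing_point:
  fixes c :: "'i multiset \<Rightarrow> complex"
  assumes A: "finite A" "A \<noteq> {}" "\<And>m. m \<in> A \<Longrightarrow> c m \<noteq> 0"
  obtains v :: "'i \<Rightarrow> nat" where "(\<Sum>m\<in>A. c m * of_nat (\<Prod>t\<in>#m. v t)) \<noteq> 0"
proof -
  define T where "T = (\<Union>m\<in>A. set_mset m)"
  define d where "d = Max (size ` A)"
  have "finite T" using A by (simp add: T_def)
  from separating_weights[OF this, of d] obtain w :: "'i \<Rightarrow> nat"
    where w: "\<And>m m'. \<lbrakk>set_mset m \<subseteq> T; size m \<le> d; set_mset m' \<subseteq> T; size m' \<le> d;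
      (\<Sum>t\<in>#m. w t) = (\<Sum>t\<in>#m'. w t)\<rbrakk> \<Longrightarrow> m = m'" by blast
  have inj: "inj_on (\<lambda>m. \<Sum>t\<in>#m. w t) A"
  proof (rule inj_onI)
    fix m m' assume m: "m \<in> A" "m' \<in> A" "(\<Sum>t\<in>#m. w t) = (\<Sum>t\<in>#m'. w t)"
    have "set_mset m \<subseteq> T" "set_mset m' \<subseteq> T" using m by (auto simp: T_def)
    moreover have "size m \<le> d" "size m' \<le> d" using m A(1) by (auto simp: d_def)
    ultimately show "m = m'" using w m(3) by blast
  qed
  define p :: "complex poly" where "p = (\<Sum>m\<in>A. monom (c m) (\<Sum>t\<in>#m. w t))"
  obtain m0 where m0: "m0 \<in> A" using A by blast
  \<comment> \<open>By injectivity of the weighted degree no other monomial contributes to this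
    coefficient.\<close>
  have "coeff p (\<Sum>t\<in>#m0. w t) = (\<Sum>m\<in>A. if m = m0 then c m else 0)"
    unfolding p_def coeff_sum coeff_monom
    using inj m0 by (intro sum.cong) (auto simp: inj_on_def)
  also have "\<dots> \<noteq> 0" using A m0 by simp
  finally have "p \<noteq> 0" by auto
  then have "finite {x. poly p x = 0}" by (rule poly_roots_finite)
  moreover have "infinite (range (of_nat :: nat \<Rightarrow> complex))"
    by (simp add: range_inj_infinite inj_of_nat)
  ultimately obtain x :: nat where x: "poly p (of_nat x) \<noteq> 0"
    using finite_subset[of "range of_nat" "{x. poly p x = 0}"] by blast
  have "(\<Prod>t\<in>#m. x ^ w t) = x ^ (\<Sum>t\<in>#m. w t)" for m :: "'i multiset"
    by (induction m) (simp_all add: power_add)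
  then have "poly p (of_nat x) = (\<Sum>m\<in>A. c m * of_nat (\<Prod>t\<in>#m. x ^ w t))"
    by (simp add: p_def poly_sum poly_monom)
  with x show thesis by (intro that) simp
qed

section \<open>Polynomial expressions in a family of series and their gaps\<close>

abbreviation fps_monomial :: "('i \<Rightarrow> complex fps) \<Rightarrow> 'i multiset \<Rightarrow> complex fps" where
  "fps_monomial F m \<equiv> (\<Prod>t\<in>#m. F t)"

text \<open>Scalars act through \<open>fps_const\<close>, as in \<open>subalgebra\<close>; this
  makes linear spans of monomials available.\<close>

interpretation fps_space: vector_space "\<lambda>c F. fps_const c * F :: complex fps"
  by standard (simp_all add: algebra_simps flip: fps_const_add fps_const_mult)

text \<open>The span of the nonempty monomials contains the generators and is closed under products,
  since monomials multiply by adding their multisets. So it contains the hull. The condition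
  \<open>m \<noteq> {#}\<close> reflects that subalgebras need not contain 1.\<close>

lemma hull_polynomial:
  assumes "G \<in> subalgebra hull (F ` T)"
  obtains A c where "finite A" "\<And>m. m \<in> A \<Longrightarrow> m \<noteq> {#} \<and> set_mset m \<subseteq> T \<and> c m \<noteq> 0"
    "G = (\<Sum>m\<in>A. fps_const (c m) * fps_monomial F m)"
proof -
  define Mon where "Mon = fps_monomial F ` {m. m \<noteq> {#} \<and> set_mset m \<subseteq> T}"
  have mult: "G * H \<in> fps_space.span Mon" if "G \<in> fps_space.span Mon" "H \<in> fps_space.span Mon" for G H
    using that(1)
  proof (induction rule: fps_space.span_induct_alt)
    case base show ?case by (simp add: fps_space.span_zero)
  next
    case (step c a x)
    have "a * H \<in> fps_space.span Mon" using that(2)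
    proof (induction rule: fps_space.span_induct_alt)
      case base show ?case by (simp add: fps_space.span_zero)
    next
      case (step c' b y)
      obtain m m' where "m \<noteq> {#}" "set_mset m \<subseteq> T" "a = fps_monomial F m"
        "m' \<noteq> {#}" "set_mset m' \<subseteq> T" "b = fps_monomial F m'"
        using step \<open>a \<in> Mon\<close> by (auto simp: Mon_def)
      then have "a * b \<in> Mon" unfolding Mon_def by (intro image_eqI[of _ _ "m + m'"]) auto
      then have "fps_const c' * (a * b) \<in> fps_space.span Mon"
        by (intro fps_space.span_scale fps_space.span_base)
      from fps_space.span_add[OF this step.IH] show ?case by (simp add: algebra_simps)
    qed
    then have "fps_const c * (a * H) \<in> fps_space.span Mon" by (rule fps_space.span_scale)
    from fps_space.span_add[OF this step.IH] show ?case by (simp add: algebra_simps)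
  qed
  have "subalgebra (fps_space.span Mon)"
    unfolding subalgebra_def
    using mult fps_space.span_zero fps_space.span_add fps_space.span_scale by blast
  moreover have "F ` T \<subseteq> fps_space.span Mon"
  proof
    fix x assume "x \<in> F ` T"
    then obtain t where "t \<in> T" "x = F t" by blast
    then have "x \<in> Mon" unfolding Mon_def by (intro image_eqI[of _ _ "{#t#}"]) auto
    then show "x \<in> fps_space.span Mon" by (rule fps_space.span_base)
  qed
  ultimately have "G \<in> fps_space.span Mon" using assms hull_minimal[of "F ` T" "fps_space.span Mon" subalgebra] by blast
  then obtain t r where t: "finite t" "t \<subseteq> Mon" "G = (\<Sum>a\<in>t. fps_const (r a) * a)"
    unfolding fps_space.span_explicit by blast
  \<comment> \<open>Different multisets could give the same series, so one representative
    \<open>e a\<close> is chosen for each series that occurs. Discarding zero coefficients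
    afterwards makes all \<open>c m\<close> nonzero.\<close>
  from t(2) have "\<forall>a\<in>t. \<exists>m. m \<noteq> {#} \<and> set_mset m \<subseteq> T \<and> fps_monomial F m = a"
    by (auto simp: Mon_def)
  then obtain e where e: "\<And>a. a \<in> t \<Longrightarrow> e a \<noteq> {#} \<and> set_mset (e a) \<subseteq> T \<and> fps_monomial F (e a) = a"
    by (auto simp: bchoice_iff)
  define t' where "t' = {a \<in> t. r a \<noteq> 0}"
  have inj: "inj_on e t'" using e by (metis (mono_tags, lifting) inj_onI mem_Collect_eq t'_def)
  show thesis
  proof
    show "finite (e ` t')" using t by (simp add: t'_def)
    show "m \<noteq> {#} \<and> set_mset m \<subseteq> T \<and> (\<lambda>m. r (fps_monomial F m)) m \<noteq> 0" if "m \<in> e ` t'" for m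
      using that e by (auto simp: t'_def)
    have "G = (\<Sum>a\<in>t'. fps_const (r a) * a)"
      unfolding t(3) t'_def using t(1) by (intro sum.mono_neutral_right) auto
    also have "\<dots> = (\<Sum>m\<in>e ` t'. fps_const (r (fps_monomial F m)) * fps_monomial F m)"
      unfolding sum.reindex[OF inj] using e by (intro sum.cong) (auto simp: t'_def)
    finally show "G = \<dots>" .
  qed
qed

text \<open>If \<open>r \<le> s * P\<close> and \<open>i - r \<le> s' * P\<close>, then
  \<open>i \<le> (s + s') * P\<close>. So above that order each product in the convolution has a
  factor with index in a gap, and at that order only \<open>r = s * P\<close> survives.\<close>

lemma gap_mult:
  fixes G H :: "'a::comm_semiring_1 fps"
  assumes G: "\<And>i. s * P < i \<Longrightarrow> i < P' \<Longrightarrow> fps_nth G i = 0"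
    and H: "\<And>i. s' * P < i \<Longrightarrow> i < P' \<Longrightarrow> fps_nth H i = 0"
  shows "\<And>i. (s + s') * P < i \<Longrightarrow> i < P' \<Longrightarrow> fps_nth (G * H) i = 0"
    and "(s + s') * P < P' \<Longrightarrow>
      fps_nth (G * H) ((s + s') * P) = fps_nth G (s * P) * fps_nth H (s' * P)"
proof -
  show "fps_nth (G * H) i = 0" if i: "(s + s') * P < i" "i < P'" for i
    unfolding fps_mult_nth
  proof (rule sum.neutral, rule ballI)
    fix r assume "r \<in> {0..i}"
    moreover have "s * P < r \<or> s' * P < i - r"
      using i by (auto simp: algebra_simps)
    ultimately show "fps_nth G r * fps_nth H (i - r) = 0" using G[of r] H[of "i - r"] i by auto
  qed
  assume lt: "(s + s') * P < P'"
  have "fps_nth (G * H) ((s + s') * P) =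
      (\<Sum>r=0..(s + s') * P. if r = s * P then fps_nth G (s * P) * fps_nth H (s' * P) else 0)"
    unfolding fps_mult_nth
  proof (rule sum.cong[OF refl])
    fix r assume r: "r \<in> {0..(s + s') * P}"
    have "fps_nth G r * fps_nth H ((s + s') * P - r) = 0" if "r \<noteq> s * P"
    proof -
      have "s * P < r \<or> s' * P < (s + s') * P - r"
        using that by (auto simp: algebra_simps)
      then show ?thesis using G[of r] H[of "(s + s') * P - r"] lt r by auto
    qed
    then show "fps_nth G r * fps_nth H ((s + s') * P - r) =
      (if r = s * P then fps_nth G (s * P) * fps_nth H (s' * P) else 0)"
      by (auto simp: algebra_simps)
  qed
  also have "\<dots> = fps_nth G (s * P) * fps_nth H (s' * P)" by (simp add: algebra_simps)
  finally show "fps_nth (G * H) ((s + s') * P) = fps_nth G (s * P) * fps_nth H (s' * P)" .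
qed

text \<open>Each factor enters \<open>gap_mult\<close> with \<open>s = 1\<close> and the empty
  product with degree 0, so the degree of the monomial multiplies \<open>P\<close>.\<close>

lemma gap_monomial:
  fixes F :: "'i \<Rightarrow> complex fps"
  assumes F: "\<And>t i. P < i \<Longrightarrow> i < P' \<Longrightarrow> fps_nth (F t) i = 0"
  shows "size m * P < i \<Longrightarrow> i < P' \<Longrightarrow> fps_nth (fps_monomial F m) i = 0"
    and "size m * P < P' \<Longrightarrow> fps_nth (fps_monomial F m) (size m * P) = (\<Prod>t\<in>#m. fps_nth (F t) P)"
proof -
  have "(\<forall>i. size m * P < i \<and> i < P' \<longrightarrow> fps_nth (fps_monomial F m) i = 0) \<and>
    (size m * P < P' \<longrightarrow> fps_nth (fps_monomial F m) (size m * P) = (\<Prod>t\<in>#m. fps_nth (F t) P))"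
  proof (induction m)
    case empty then show ?case by auto
  next
    case (add t m)
    have "fps_nth (F t * fps_monomial F m) i = 0" if "(1 + size m) * P < i" "i < P'" for i
      using add by (intro gap_mult(1)[OF _ _ that]) (auto intro: F)
    moreover have "fps_nth (F t * fps_monomial F m) ((1 + size m) * P) =
        fps_nth (F t) (1 * P) * fps_nth (fps_monomial F m) (size m * P)" if "(1 + size m) * P < P'"
      using add by (intro gap_mult(2)[OF _ _ that]) (auto intro: F)
    ultimately show ?case using add by auto
  qed
  then show "size m * P < i \<Longrightarrow> i < P' \<Longrightarrow> fps_nth (fps_monomial F m) i = 0"
    and "size m * P < P' \<Longrightarrow> fps_nth (fps_monomial F m) (size m * P) = (\<Prod>t\<in>#m. fps_nth (F t) P)"
    by blast+
qed

text \<open>For products, \<open>N i * N (j - i) \<le> N j\<close> turns the convolution of the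
  weights into a sum of binomial coefficients times \<open>n j\<close>. The resulting factor
  \<open>2 ^ j\<close> is compensated by bounding both factors with \<open>h / 2\<close>.\<close>

lemma subalgebra_beurling_series:
  assumes "weight_sequence N"
  shows "subalgebra (beurling_series N)"
proof -
  note pos = weight_sequence_pos[OF assms]
  define n where "n = over_fact N"
  have npos: "0 < n j" for j using pos by (simp add: n_def over_fact_def)
  have bound_iff: "series_bound N h F \<longleftrightarrow> (\<exists>B. \<forall>j. norm (fps_nth F j) \<le> B * (h ^ j * n j))" if "0 < h" for h F
    using that npos by (auto simp: series_bound_def bdd_above_def n_def[symmetric] pos_divide_le_eq)
  have conv: "(\<Sum>i=0..j. n i * n (j - i)) \<le> 2 ^ j * n j" for j
  proof -
    have "(\<Sum>i=0..j. n i * n (j - i)) \<le> (\<Sum>i=0..j. real (j choose i) * n j)"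
    proof (rule sum_mono)
      fix i assume i: "i \<in> {0..j}"
      have "n i * n (j - i) = N i * N (j - i) / (fact i * fact (j - i))"
        by (simp add: n_def over_fact_def)
      also have "\<dots> \<le> N (i + (j - i)) / (fact i * fact (j - i))"
        by (intro divide_right_mono weight_sequence_mult_le[OF assms]) simp
      also have "\<dots> = real (j choose i) * n j"
        using i by (simp add: n_def over_fact_def binomial_fact)
      finally show "n i * n (j - i) \<le> real (j choose i) * n j" .
    qed
    also have "\<dots> = 2 ^ j * n j"
      unfolding sum_distrib_right[symmetric] atLeast0AtMost
      by (simp flip: of_nat_sum add: choose_row_sum)
    finally show ?thesis .
  qed
  have "F * G \<in> beurling_series N" if FG: "F \<in> beurling_series N" "G \<in> beurling_series N" for F G
    unfolding beurling_series_def mem_Collect_eq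
  proof (intro allI impI)
    fix h :: real assume h: "0 < h"
    obtain B where B: "\<And>j. norm (fps_nth F j) \<le> B * ((h/2) ^ j * n j)"
      using FG(1) h bound_iff[of "h/2" F] by (auto simp: beurling_series_def)
    obtain B' where B': "\<And>j. norm (fps_nth G j) \<le> B' * ((h/2) ^ j * n j)"
      using FG(2) h bound_iff[of "h/2" G] by (auto simp: beurling_series_def)
    have B0: "0 \<le> B" "0 \<le> B'"
      using order_trans[OF norm_ge_zero B[of 0]] order_trans[OF norm_ge_zero B'[of 0]] npos[of 0]
      by (auto simp: zero_le_mult_iff)
    have "norm (fps_nth (F * G) j) \<le> B * B' * (h ^ j * n j)" for j
    proof -
      have "norm (fps_nth (F * G) j) \<le> (\<Sum>i=0..j. norm (fps_nth F i * fps_nth G (j - i)))"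
        unfolding fps_mult_nth by (rule norm_sum)
      also have "\<dots> \<le> (\<Sum>i=0..j. B * B' * (h/2) ^ j * (n i * n (j - i)))"
      proof (rule sum_mono)
        fix i assume i: "i \<in> {0..j}"
        have "norm (fps_nth F i * fps_nth G (j - i)) \<le>
            (B * ((h/2) ^ i * n i)) * (B' * ((h/2) ^ (j - i) * n (j - i)))"
          unfolding norm_mult using B B' B0 npos h by (intro mult_mono) (auto simp: less_imp_le)
        also have "\<dots> = B * B' * ((h/2) ^ i * (h/2) ^ (j - i)) * (n i * n (j - i))" by (simp only: mult_ac)
        also have "(h/2) ^ i * (h/2) ^ (j - i) = (h/2) ^ j" using i by (simp flip: power_add)
        finally show "norm (fps_nth F i * fps_nth G (j - i)) \<le> B * B' * (h/2) ^ j * (n i * n (j - i))" .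
      qed
      also have "\<dots> = B * B' * (h/2) ^ j * (\<Sum>i=0..j. n i * n (j - i))"
        by (simp only: sum_distrib_left)
      also have "\<dots> \<le> B * B' * (h/2) ^ j * (2 ^ j * n j)"
        using B0 h conv by (intro mult_left_mono) auto
      finally show ?thesis by (simp add: power_divide)
    qed
    then show "series_bound N h (F * G)" using bound_iff[OF h] by blast
  qed
  moreover have "F + G \<in> beurling_series N" if FG: "F \<in> beurling_series N" "G \<in> beurling_series N" for F G
    unfolding beurling_series_def mem_Collect_eq
  proof (intro allI impI)
    fix h :: real assume h: "0 < h"
    obtain B where B: "\<And>j. norm (fps_nth F j) \<le> B * (h ^ j * n j)"
      using FG(1) h bound_iff[of h F] by (auto simp: beurling_series_def)
    obtain B' where B': "\<And>j. norm (fps_nth G j) \<le> B' * (h ^ j * n j)"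
      using FG(2) h bound_iff[of h G] by (auto simp: beurling_series_def)
    have "norm (fps_nth (F + G) j) \<le> (B + B') * (h ^ j * n j)" for j
      using norm_triangle_ineq[of "fps_nth F j" "fps_nth G j"] B[of j] B'[of j]
      by (simp only: fps_add_nth distrib_right)
    then show "series_bound N h (F + G)" using bound_iff[OF h] by blast
  qed
  moreover have "fps_const c * F \<in> beurling_series N" if F: "F \<in> beurling_series N" for c F
    unfolding beurling_series_def mem_Collect_eq
  proof (intro allI impI)
    fix h :: real assume h: "0 < h"
    obtain B where "\<And>j. norm (fps_nth F j) \<le> B * (h ^ j * n j)"
      using F h bound_iff[of h F] by (auto simp: beurling_series_def)
    then have "norm (fps_nth (fps_const c * F) j) \<le> (norm c * B) * (h ^ j * n j)" for j
      by (simp only: fps_mult_left_const_nth norm_mult mult.assoc) (simp add: mult_left_mono)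
    then show "series_bound N h (fps_const c * F)" using bound_iff[OF h] by blast
  qed
  moreover have "0 \<in> beurling_series N" by (simp add: beurling_series_def series_bound_def)
  ultimately show ?thesis unfolding subalgebra_def by blast
qed

section \<open>Algebras of series outside the Borel image\<close>

lemma nderiv_Suc: "nderiv (Suc j) f = (\<lambda>x. vector_derivative (nderiv j f) (at x))"
  by (simp add: nderiv_def)

lemma nderiv_0 [simp]: "nderiv 0 f = f"
  by (simp add: nderiv_def)

lemma nderiv_has_vector_derivative:
  assumes "f \<in> smooth_functions U" "x \<in> U"
  shows "(nderiv j f has_vector_derivative nderiv (Suc j) f x) (at x)"
  using assms by (simp add: smooth_functions_def nderiv_Suc vector_derivative_works)

lemma fps_nth_borel_map: "fps_nth (borel_map (germ_of f)) j = nderiv j f 0 / fact j"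
  by transfer simp

lemma ultradiff_bound_iff:
  assumes "0 < h" "\<And>j. 0 < M j"
  shows "ultradiff_bound M K h f \<longleftrightarrow> (\<exists>C. \<forall>j. \<forall>x\<in>K. norm (nderiv j f x) \<le> C * (h ^ j * M j))"
  using assms by (auto simp: ultradiff_bound_def bdd_above_def pos_divide_le_eq)

lemma beurling_germs_subset_roumieu_germs: "beurling_germs M \<subseteq> roumieu_germs M"
proof -
  have "beurling_functions M U \<subseteq> roumieu_functions M U" for U
    by (auto simp: beurling_functions_def roumieu_functions_def intro!: exI[of _ 1])
  then show ?thesis
    unfolding beurling_germs_def roumieu_germs_def germs_at_0_def by blast
qed

lemma beurling_series_subset_roumieu_series: "beurling_series M \<subseteq> roumieu_series M"
  by (auto simp: beurling_series_def roumieu_series_def intro!: exI[of _ 1])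

text \<open>With this, a polynomial expression outside the image is in particular nonzero, so
  avoiding the image entails algebraic independence.\<close>

lemma zero_in_roumieu_image: "0 \<in> borel_map ` roumieu_germs M"
proof -
  have z: "nderiv j (\<lambda>x. 0) = (\<lambda>x. 0)" for j
    by (induction j) (simp_all add: nderiv_Suc)
  have "(\<lambda>x. 0) \<in> roumieu_functions M {- (1 / real 1)<..<1 / real 1}"
    by (auto simp: roumieu_functions_def smooth_functions_def z ultradiff_bound_def case_prod_unfold
        intro!: exI[of _ 1])
  then have "germ_of (\<lambda>x. 0) \<in> roumieu_germs M"
    unfolding roumieu_germs_def germs_at_0_def by blast
  moreover have "borel_map (germ_of (\<lambda>x. 0)) = 0"
    by (simp add: fps_eq_iff fps_nth_borel_map z)
  ultimately show ?thesis by (metis imageI)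
qed

text \<open>Brings a germ into the shape required by \<open>gap_coefficient_bound\<close>: a compact
  interval to the right of 0 inside the domain, and constants raised to at least 1.\<close>

lemma roumieu_image_bound:
  assumes M: "weight_sequence M" and F: "F \<in> borel_map ` roumieu_germs M"
  obtains f a C h where "0 < a" "a \<le> 1" "0 < C" "1 \<le> h"
    "\<And>j t. t \<in> {0..a} \<Longrightarrow> (f j has_vector_derivative f (Suc j) t) (at t)"
    "\<And>j t. t \<in> {0..a} \<Longrightarrow> norm (f j t) \<le> C * h ^ j * M j"
    "\<And>j. fps_nth F j = f j 0 / fact j"
proof -
  note pos = weight_sequence_pos[OF M]
  obtain k :: nat and g where k: "k \<ge> 1"
    and g: "g \<in> roumieu_functions M {- (1 / real k)<..<1 / real k}"
    and Fg: "F = borel_map (germ_of g)"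
    using F by (auto simp: roumieu_germs_def germs_at_0_def)
  define a where "a = 1 / (2 * real k)"
  have a: "0 < a" "a \<le> 1" "a < 1 / real k" using k by (simp_all add: a_def field_simps)
  then have sub: "{0..a} \<subseteq> {- (1 / real k)<..<1 / real k}" by auto
  then obtain h where h: "0 < h" "ultradiff_bound M {0..a} h g"
    using g by (auto simp: roumieu_functions_def)
  then obtain C where C: "\<And>j t. t \<in> {0..a} \<Longrightarrow> norm (nderiv j g t) \<le> C * (h ^ j * M j)"
    using iffD1[OF ultradiff_bound_iff[OF h(1) pos] h(2)] by blast
  show thesis
  proof
    show "0 < a" "a \<le> 1" "0 < max 1 C" "1 \<le> max 1 h" using a by auto
    show "(nderiv j g has_vector_derivative nderiv (Suc j) g t) (at t)" if "t \<in> {0..a}" for j t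
      using g sub that by (intro nderiv_has_vector_derivative) (auto simp: roumieu_functions_def)
    show "norm (nderiv j g t) \<le> max 1 C * max 1 h ^ j * M j" if "t \<in> {0..a}" for j t
    proof -
      have "C * (h ^ j * M j) \<le> max 1 C * (max 1 h ^ j * M j)"
        using h(1) pos[of j] by (intro mult_mono power_mono) auto
      then show ?thesis using C[OF that, of j] by simp
    qed
    show "fps_nth F j = nderiv j g 0 / fact j" for j by (simp add: Fg fps_nth_borel_map)
  qed
qed

lemma quasianalytic_tail_unbounded:
  assumes "weight_sequence M" "quasianalytic M"
  shows "\<exists>n. B \<le> (\<Sum>i=L..<n. M i / M (Suc i))"
proof (rule ccontr)
  note pos = weight_sequence_pos[OF assms(1)]
  assume "\<nexists>n. B \<le> (\<Sum>i=L..<n. M i / M (Suc i))"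
  then have B: "(\<Sum>i=L..<n. M i / M (Suc i)) \<le> B" for n by (meson linear)
  have "summable (\<lambda>i. M (i + L) / M (Suc (i + L)))"
  proof (rule summableI_nonneg_bounded)
    show "0 \<le> M (n + L) / M (Suc (n + L))" for n using pos by (simp add: less_imp_le)
    show "(\<Sum>i<n. M (i + L) / M (Suc (i + L))) \<le> B" for n
      using B[of "n + L"] sum.shift_bounds_nat_ivl[of "\<lambda>i. M i / M (Suc i)" 0 L n]
      by (simp add: atLeast0LessThan)
  qed
  then have "summable (\<lambda>i. M i / M (Suc i))" by (simp add: summable_iff_shift[of "\<lambda>i. M i / M (Suc i)"])
  then show False using assms(2) by (simp add: quasianalytic_def)
qed

section \<open>Generators supported on superlacunary exponents\<close>

text \<open>Dependent choice. Each exponent is taken large enough for the weight to dominate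
  \<open>real k ^ (2 * p k)\<close>, and the next one so large that the conditions of
  \<open>gap_coefficient_bound\<close> hold with \<open>k * p k\<close> for \<open>q\<close> and
  \<open>k\<close> for \<open>h\<close>. Any fixed degree and any fixed \<open>h\<close> are thus
  covered for all large \<open>k\<close>.\<close>

lemma superlacunary_exponents:
  assumes M: "weight_sequence M" "quasianalytic M"
    and N: "\<And>B m. \<exists>j\<ge>m. B ^ j \<le> over_fact N j"
  obtains p :: "nat \<Rightarrow> nat" where "strict_mono p" "\<And>k. 0 < p k"
    "\<And>k. real k ^ (2 * p k) \<le> over_fact N (p k)"
    "\<And>k. k * p k < p (Suc k)"
    "\<And>k. \<exists>L. 1 + 3 * real k ^ (k * p k) * M (k * p k) \<le> exp (real L) \<and>
       3 * real k \<le> (\<Sum>i=L..<p (Suc k). M i / M (Suc i))"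
proof -
  note pos = weight_sequence_pos[OF M(1)]
  define P where "P k x \<longleftrightarrow> 0 < x \<and> real k ^ (2 * x) \<le> over_fact N x" for k x :: nat
  define Q where "Q k x y \<longleftrightarrow> x < y \<and> k * x < y \<and>
      (\<exists>L. 1 + 3 * real k ^ (k * x) * M (k * x) \<le> exp (real L) \<and>
       3 * real k \<le> (\<Sum>i=L..<y. M i / M (Suc i)))" for k x y :: nat
  have ex: "\<exists>x\<ge>m. P k x" for m k
  proof -
    obtain x where "x \<ge> Suc m" "(real k ^ 2) ^ x \<le> over_fact N x" using N by blast
    then show ?thesis by (intro exI[of _ x]) (simp add: P_def power_mult)
  qed
  have "\<exists>p. \<forall>k. P k (p k) \<and> Q k (p k) (p (Suc k))"
  proof (rule dependent_nat_choice)
    show "\<exists>x. P 0 x" using ex by blast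
    fix x k
    obtain L :: nat where "1 + 3 * real k ^ (k * x) * M (k * x) \<le> real L"
      using real_arch_simple by blast
    also have "real L \<le> exp (real L)" using exp_ge_add_one_self[of "real L"] by linarith
    finally have L: "1 + 3 * real k ^ (k * x) * M (k * x) \<le> exp (real L)" .
    obtain n where n: "3 * real k \<le> (\<Sum>i=L..<n. M i / M (Suc i))"
      using quasianalytic_tail_unbounded[OF M] by blast
    obtain y where y: "y \<ge> Suc (x + k * x + n)" "P (Suc k) y" using ex by blast
    have "(\<Sum>i=L..<n. M i / M (Suc i)) \<le> (\<Sum>i=L..<y. M i / M (Suc i))"
      using y pos by (intro sum_mono2) (auto simp: less_imp_le)
    then have "Q k x y" unfolding Q_def using y L n by (intro conjI exI[of _ L]) auto
    then show "\<exists>y. P (Suc k) y \<and> Q k x y" using y by blast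
  qed
  then obtain p where p: "\<And>k. P k (p k)" "\<And>k. Q k (p k) (p (Suc k))" by blast
  show thesis
  proof
    show "strict_mono p" using p(2) by (simp add: strict_mono_Suc_iff Q_def)
  qed (use p in \<open>auto simp: P_def Q_def\<close>)
qed

text \<open>The series with terms \<open>b k * X ^ p k\<close>, encoded by a sum over the fibre of
  \<open>p\<close>: for injective \<open>p\<close> it has at most one term, and off the range of
  \<open>p\<close> it is empty and hence 0.\<close>

definition lacunary :: "(nat \<Rightarrow> nat) \<Rightarrow> (nat \<Rightarrow> 'a::comm_monoid_add) \<Rightarrow> 'a fps" where
  "lacunary p b = Abs_fps (\<lambda>i. \<Sum>k | p k = i. b k)"

lemma lacunary_nth:
  assumes "strict_mono p"
  shows "fps_nth (lacunary p b) (p k) = b k"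
proof -
  have "{k'. p k' = p k} = {k}" using strict_mono_eq[OF assms] by auto
  then show ?thesis by (simp add: lacunary_def)
qed

lemma lacunary_nth_eq_0: "i \<notin> range p \<Longrightarrow> fps_nth (lacunary p b) i = 0"
  by (auto simp: lacunary_def intro!: sum.neutral)

lemma lacunary_nth_gap:
  assumes "strict_mono p" "p k < i" "i < p (Suc k)"
  shows "fps_nth (lacunary p b) i = 0"
proof (rule lacunary_nth_eq_0, rule notI)
  assume "i \<in> range p"
  then obtain l where "i = p l" by blast
  then show False using assms by (simp add: strict_mono_less)
qed

text \<open>The family is indexed by \<open>nat set\<close> to have continuum size. The second
  property covers every nontrivial polynomial without constant term, and therefore also yields
  algebraic independence.\<close>

theorem free_generators_outside_image:
  assumes M: "weight_sequence M" "quasianalytic M" and N: "weight_sequence N"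
    and unb: "\<And>B m. \<exists>j\<ge>m. B ^ j \<le> over_fact N j"
  obtains F :: "nat set \<Rightarrow> complex fps" where "\<And>t. F t \<in> beurling_series N"
    "\<And>A c. \<lbrakk>finite A; A \<noteq> {}; \<And>m. m \<in> A \<Longrightarrow> m \<noteq> {#} \<and> c m \<noteq> 0\<rbrakk> \<Longrightarrow>
      (\<Sum>m\<in>A. fps_const (c m) * fps_monomial F m) \<notin> borel_map ` roumieu_germs M"
proof -
  obtain p where p: "strict_mono p" "\<And>k. 0 < p k"
    "\<And>k. real k ^ (2 * p k) \<le> over_fact N (p k)"
    "\<And>k. k * p k < p (Suc k)"
    "\<And>k. \<exists>L. 1 + 3 * real k ^ (k * p k) * M (k * p k) \<le> exp (real L) \<and>
       3 * real k \<le> (\<Sum>i=L..<p (Suc k). M i / M (Suc i))"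
    by (rule superlacunary_exponents[OF M unb]) blast
  have kp: "k \<le> p k" for k by (rule strict_mono_imp_increasing[OF p(1)])
  obtain s :: "nat set \<Rightarrow> nat \<Rightarrow> nat" where s: "\<And>t k. s t k \<le> k"
    "\<And>X v K. finite X \<Longrightarrow> \<exists>k\<ge>K. \<forall>t\<in>X. s t k = v t"
    by (rule independent_family) blast
  define F where "F t = lacunary p (\<lambda>k. of_nat (k ^ p k * s t k) :: complex)" for t
  show thesis
  proof
    fix t
    show "F t \<in> beurling_series N"
      unfolding beurling_series_def mem_Collect_eq
    proof (intro allI impI)
      fix h :: real assume h: "0 < h"
      define r where "r j = norm (fps_nth (F t) j) / (h ^ j * over_fact N j)" for j
      \<comment> \<open>For \<open>k > K\<close> the product \<open>h * real k\<close> is at least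
        2, so \<open>(h * real k) ^ p k\<close> exceeds \<open>s t k \<le> p k\<close>. This uses
        one of the two factors \<open>real k ^ p k\<close> available below the weight; the
        coefficient itself uses the other.\<close>
      obtain K :: nat where K: "2 / h \<le> real K" using real_arch_simple by blast
      have "r j \<le> 1" if j: "j \<ge> p (Suc K)" for j
      proof (cases "j \<in> range p")
        case False then show ?thesis by (simp add: r_def F_def lacunary_nth_eq_0)
      next
        case True
        then obtain k where k: "j = p k" by blast
        have "Suc K \<le> k" using j p(1) by (simp add: k strict_mono_less_eq)
        then have "2 / h \<le> real k" "0 < k" using K by auto
        then have hk: "2 \<le> h * real k" using h by (simp add: field_simps)
        have "norm (fps_nth (F t) j) = real k ^ p k * real (s t k)"
          by (simp add: F_def k lacunary_nth[OF p(1)] norm_mult norm_power)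
        also have "\<dots> \<le> real k ^ p k * 2 ^ p k"
        proof -
          have "real (s t k) \<le> real (p k)" using s(1)[of t k] kp[of k] by simp
          also have "\<dots> \<le> 2 ^ p k" by simp
          finally show ?thesis by (simp add: mult_left_mono)
        qed
        also have "\<dots> \<le> real k ^ p k * (h * real k) ^ p k"
          using hk by (intro mult_left_mono power_mono) auto
        also have "\<dots> = h ^ p k * real k ^ (2 * p k)"
          by (simp add: power_mult_distrib power_mult power2_eq_square)
        also have "\<dots> \<le> h ^ p k * over_fact N (p k)"
          using h p(3) by (intro mult_left_mono) auto
        finally show ?thesis
          using h weight_sequence_pos[OF N, of j] by (simp add: r_def k over_fact_def field_simps)
      qed
      then have "r j \<le> Max (insert 1 (r ` {..<p (Suc K)}))" for j
        by (cases "j < p (Suc K)") (auto intro: Max_ge simp: Max_ge_iff not_less)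
      then have "bdd_above (range r)" by (auto simp: bdd_above_def)
      then show "series_bound N h (F t)" by (simp add: series_bound_def r_def[abs_def])
    qed
  next
    fix A and c :: "nat set multiset \<Rightarrow> complex"
    assume A: "finite A" "A \<noteq> {}" "\<And>m. m \<in> A \<Longrightarrow> m \<noteq> {#} \<and> c m \<noteq> 0"
    define G where "G = (\<Sum>m\<in>A. fps_const (c m) * fps_monomial F m)"
    define d where "d = Max (size ` A)"
    define Ad where "Ad = {m \<in> A. size m = d}"
    have dle: "size m \<le> d" if "m \<in> A" for m using that A by (simp add: d_def)
    have "d \<in> size ` A" unfolding d_def using A by (intro Max_in) auto
    then obtain m0 where m0: "m0 \<in> Ad" by (auto simp: Ad_def)
    then have d0: "0 < d" using A(3)[of m0] by (auto simp: Ad_def nonempty_has_size)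
    obtain v where v: "(\<Sum>m\<in>Ad. c m * of_nat (\<Prod>t\<in>#m. v t)) \<noteq> 0"
      by (rule nonvanishing_point[of Ad c]) (use A m0 in \<open>auto simp: Ad_def\<close>)
    \<comment> \<open>The value of the top homogeneous part at \<open>v\<close>. It is fixed before
      \<open>k\<close>, which can therefore be taken large compared with
      \<open>1 / norm z\<close>.\<close>
    define z where "z = (\<Sum>m\<in>Ad. c m * of_nat (\<Prod>t\<in>#m. v t))"
    have z0: "0 < norm z" using v by (simp add: z_def)
    show "(\<Sum>m\<in>A. fps_const (c m) * fps_monomial F m) \<notin> borel_map ` roumieu_germs M"
    proof
      assume "(\<Sum>m\<in>A. fps_const (c m) * fps_monomial F m) \<in> borel_map ` roumieu_germs M"
      then have "G \<in> borel_map ` roumieu_germs M" by (simp add: G_def)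
      then obtain f a C h where f: "0 < a" "a \<le> 1" "0 < C" "1 \<le> h"
        "\<And>j t. t \<in> {0..a} \<Longrightarrow> (f j has_vector_derivative f (Suc j) t) (at t)"
        "\<And>j t. t \<in> {0..a} \<Longrightarrow> norm (f j t) \<le> C * h ^ j * M j"
        "\<And>j. fps_nth G j = f j 0 / fact j"
        by (rule roumieu_image_bound[OF M(1)]) blast
      \<comment> \<open>All summands are nonnegative, so \<open>k \<ge> K\<close> is at once above
        \<open>h\<close>, \<open>d\<close>, \<open>4 * exp 1 / a\<close> and
        \<open>2 * C / norm z\<close>, the last one strictly.\<close>
      obtain K :: nat where K: "h + real d + 4 * exp 1 / a + (2 * C / norm z + 1) \<le> real K"
        using real_arch_simple by blast
      have "finite (\<Union>m\<in>A. set_mset m)" using A by auto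
      from s(2)[OF this, of K v] obtain k where k: "k \<ge> K" "\<And>t. t \<in> (\<Union>m\<in>A. set_mset m) \<Longrightarrow> s t k = v t"
        by blast
      have kK: "h + real d + 4 * exp 1 / a + (2 * C / norm z + 1) \<le> real k" using K k(1) by linarith
      have nonneg: "0 \<le> 4 * exp 1 / a" "0 \<le> 2 * C / norm z" using f by auto
      have hk: "h \<le> real k" and dk: "d \<le> k" and ak: "4 * exp 1 / a \<le> real k"
        and zk: "2 * C / norm z < real k"
        using kK nonneg f(4) by linarith+
      define q where "q = d * p k"
      have qk: "q \<le> k * p k" using dk by (simp add: q_def)
      then have qp: "q < p (Suc k)" using p(4)[of k] by simp
      have gapF: "fps_nth (F t) i = 0" if "p k < i" "i < p (Suc k)" for t i
        unfolding F_def using lacunary_nth_gap[OF p(1) that] .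
      have gapG: "fps_nth G i = 0" if i: "q < i" "i < p (Suc k)" for i
      proof -
        have "fps_nth (fps_monomial F m) i = 0" if "m \<in> A" for m
        proof (rule gap_monomial(1)[of "p k" "p (Suc k)", OF gapF _ i(2)])
          have "size m * p k \<le> q" using dle[OF that] by (simp add: q_def)
          then show "size m * p k < i" using i by simp
        qed
        then show ?thesis by (simp add: G_def fps_sum_nth)
      qed
      have mon: "fps_nth (fps_monomial F m) q =
          (if size m = d then of_nat (k ^ q) * of_nat (\<Prod>t\<in>#m. v t) else 0)" if m: "m \<in> A" for m
      proof (cases "size m = d")
        \<comment> \<open>The degree is then smaller than \<open>d\<close>, and since
          \<open>p k > 0\<close> the order \<open>q\<close> lies inside the gap of this
          monomial.\<close>
        case False
        then have "size m * p k < q" using dle[OF m] p(2)[of k] by (simp add: q_def)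
        then show ?thesis using False gap_monomial(1)[of "p k" "p (Suc k)", OF gapF _ qp] by simp
      next
        case True
        have "fps_nth (fps_monomial F m) q = (\<Prod>t\<in>#m. fps_nth (F t) (p k))"
          using gap_monomial(2)[of "p k" "p (Suc k)" F m, OF gapF] qp True by (simp add: q_def)
        also have "image_mset (\<lambda>t. fps_nth (F t) (p k)) m = image_mset (\<lambda>t. of_nat (k ^ p k * v t)) m"
          using k(2) m by (intro image_mset_cong) (auto simp: F_def lacunary_nth[OF p(1)])
        also have "prod_mset \<dots> = of_nat ((k ^ p k) ^ size m * (\<Prod>t\<in>#m. v t))"
          by (induction m) (simp_all add: algebra_simps)
        also have "(k ^ p k) ^ size m = k ^ q"
          using True by (simp add: q_def mult.commute flip: power_mult)
        finally show ?thesis using True by simp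
      qed
      have "fps_nth G q = (\<Sum>m\<in>A. c m * (if size m = d then of_nat (k ^ q) * of_nat (\<Prod>t\<in>#m. v t) else 0))"
        unfolding G_def fps_sum_nth fps_mult_left_const_nth
        by (intro sum.cong refl) (simp only: mon)
      also have "\<dots> = (\<Sum>m\<in>Ad. c m * (of_nat (k ^ q) * of_nat (\<Prod>t\<in>#m. v t)))"
        unfolding Ad_def using A(1) by (simp add: sum.inter_filter if_distrib cong: if_cong)
      also have "\<dots> = of_nat (k ^ q) * z"
        by (simp add: z_def sum_distrib_left mult_ac)
      finally have Gq: "fps_nth G q = of_nat (k ^ q) * z" .
      obtain L where L: "1 + 3 * real k ^ (k * p k) * M (k * p k) \<le> exp (real L)"
        "3 * real k \<le> (\<Sum>i=L..<p (Suc k). M i / M (Suc i))"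
        using p(5) by blast
      have "norm (f q 0 / fact q) \<le> 2 * C * (2 * exp 1 / a) ^ q"
      proof (rule gap_coefficient_bound[OF M(1) f(5,6,3,4,1,2)])
        show "f i 0 = 0" if "q < i" "i < p (Suc k)" for i using gapG[OF that] f(7)[of i] by simp
        have "h ^ q \<le> real k ^ q" using f(4) hk by (intro power_mono) auto
        also have "\<dots> \<le> real k ^ (k * p k)" using f(4) hk qk by (intro power_increasing) auto
        finally have "h ^ q * M q \<le> real k ^ (k * p k) * M (k * p k)"
          using incseqD[OF weight_sequence_incseq[OF M(1)] qk] weight_sequence_pos[OF M(1), of q]
          by (intro mult_mono) auto
        then show "1 + 3 * h ^ q * M q \<le> exp (real L)" using L(1) by simp
        show "3 * h \<le> (\<Sum>i=L..<p (Suc k). M i / M (Suc i))" using L(2) hk by simp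
      qed auto
      then have bound: "real k ^ q * norm z \<le> 2 * C * (2 * exp 1 / a) ^ q"
        unfolding f(7)[symmetric] Gq by (simp add: norm_mult norm_power)
      \<comment> \<open>Since \<open>real k\<close> is at least twice the base
        \<open>2 * exp 1 / a\<close>, cancelling that base to the power \<open>q\<close> leaves a
        spare factor \<open>2 ^ q\<close>. It exceeds \<open>k\<close> because
        \<open>q \<ge> k\<close>, and \<open>k\<close> already exceeds
        \<open>2 * C / norm z\<close>.\<close>
      have "(2 * (2 * exp 1 / a)) ^ q * norm z \<le> real k ^ q * norm z"
        using ak f(1) by (intro mult_right_mono power_mono) auto
      then have "(2 * exp 1 / a) ^ q * (2 ^ q * norm z) \<le> (2 * exp 1 / a) ^ q * (2 * C)"
        using bound by (simp only: power_mult_distrib mult_ac)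
      then have "2 ^ q * norm z \<le> 2 * C" using f(1) by (subst (asm) mult_le_cancel_left_pos) auto
      moreover have "real k < 2 ^ q"
      proof -
        have "k \<le> q" using kp[of k] d0 by (auto simp: q_def intro: order_trans)
        then have "real k \<le> real q" by simp
        also have "\<dots> < 2 ^ q" by simp
        finally show ?thesis .
      qed
      moreover have "2 * C < real k * norm z" using zk z0 by (simp add: field_simps)
      moreover have "real k * norm z \<le> 2 ^ q * norm z" using calculation(2) by (intro mult_right_mono) auto
      ultimately show False by linarith
    qed
  qed
qed

text \<open>Stated for any \<open>A\<close> above the Beurling series and any \<open>I\<close> below
  the Roumieu image, so that the same algebra settles all four claims.\<close>

theorem algebrable_complement:
  assumes M: "weight_sequence M" "quasianalytic M" and N: "weight_sequence N"
    and unb: "\<And>B m. \<exists>j\<ge>m. B ^ j \<le> over_fact N j"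
    and A: "beurling_series N \<subseteq> A" and I: "I \<subseteq> borel_map ` roumieu_germs M"
  shows "algebrable (UNIV :: real set) A (A - I)"
proof -
  obtain F :: "nat set \<Rightarrow> complex fps" where F: "\<And>t. F t \<in> beurling_series N"
    and free: "\<And>A c. \<lbrakk>finite A; A \<noteq> {}; \<And>m. m \<in> A \<Longrightarrow> m \<noteq> {#} \<and> c m \<noteq> 0\<rbrakk> \<Longrightarrow>
      (\<Sum>m\<in>A. fps_const (c m) * fps_monomial F m) \<notin> borel_map ` roumieu_germs M"
    by (rule free_generators_outside_image[OF M N unb]) blast
  have not0: "(\<Sum>m\<in>B. fps_const (c m) * fps_monomial F m) \<noteq> 0"
    if "finite B" "B \<noteq> {}" "\<And>m. m \<in> B \<Longrightarrow> m \<noteq> {#} \<and> c m \<noteq> 0" for B c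
    using free[of B c] that zero_in_roumieu_image[of M] by metis
  define C where "C = subalgebra hull (range F)"
  have not_in: "F t \<notin> subalgebra hull (F ` T)" if "t \<notin> T" for t T
  proof
    assume "F t \<in> subalgebra hull (F ` T)"
    then obtain B c where B: "finite B" "\<And>m. m \<in> B \<Longrightarrow> m \<noteq> {#} \<and> set_mset m \<subseteq> T \<and> c m \<noteq> 0"
      "F t = (\<Sum>m\<in>B. fps_const (c m) * fps_monomial F m)"
      by (rule hull_polynomial) blast
    have tB: "{#t#} \<notin> B" using B(2)[of "{#t#}"] that by auto
    \<comment> \<open>Moving \<open>F t\<close> to the other side gives a relation among the
      generators. It is nontrivial because the monomial \<open>{#t#}\<close> does not occur in
      \<open>B\<close>, so its coefficient is exactly -1.\<close>
    define c' where "c' = c({#t#} := -1)"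
    have "(\<Sum>m\<in>insert {#t#} B. fps_const (c' m) * fps_monomial F m) =
        fps_const (-1) * F t + (\<Sum>m\<in>B. fps_const (c' m) * fps_monomial F m)"
      using B(1) tB by (simp add: c'_def)
    also have "(\<Sum>m\<in>B. fps_const (c' m) * fps_monomial F m) = F t"
      unfolding B(3) using tB by (intro sum.cong) (auto simp: c'_def)
    also have "fps_const (-1) * F t + F t = 0" by (simp flip: fps_const_neg)
    finally have "(\<Sum>m\<in>insert {#t#} B. fps_const (c' m) * fps_monomial F m) = 0" .
    moreover have "m \<noteq> {#} \<and> c' m \<noteq> 0" if "m \<in> insert {#t#} B" for m
      using that B(2) by (auto simp: c'_def)
    ultimately show False using not0[of "insert {#t#} B" c'] B(1) by blast
  qed
  have alg: "subalgebra C"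
    unfolding C_def by (rule hull_in) (auto simp: subalgebra_def)
  have "C \<subseteq> beurling_series N"
    unfolding C_def using F subalgebra_beurling_series[OF N] by (intro hull_minimal) auto
  then have CA: "C \<subseteq> A" using A by blast
  have "C \<subseteq> (A - I) \<union> {0}"
  proof
    fix G assume G: "G \<in> C"
    then obtain B c where B: "finite B" "\<And>m. m \<in> B \<Longrightarrow> m \<noteq> {#} \<and> set_mset m \<subseteq> UNIV \<and> c m \<noteq> 0"
      "G = (\<Sum>m\<in>B. fps_const (c m) * fps_monomial F m)"
      unfolding C_def by (rule hull_polynomial[of G F UNIV]) blast
    show "G \<in> (A - I) \<union> {0}"
    proof (cases "B = {}")
      case True then show ?thesis using B(3) by simp
    next
      case False
      then show ?thesis using free[OF B(1) False, of c] B(2,3) G CA I by blast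
    qed
  qed
  moreover have "minimal_generators C (range F)"
    unfolding minimal_generators_def
  proof (intro conjI allI impI)
    show "subalgebra hull range F = C" by (simp add: C_def)
    fix S assume S: "S \<subset> range F"
    then obtain t where t: "F t \<notin> S" by blast
    have "S = F ` {u. F u \<in> S}" using S by blast
    then have "F t \<notin> subalgebra hull S" using not_in[of t "{u. F u \<in> S}"] t by simp
    moreover have "F t \<in> C" unfolding C_def by (rule hull_inc) simp
    ultimately show "subalgebra hull S \<noteq> C" by blast
  qed
  moreover have "range F \<approx> (UNIV :: real set)"
  proof -
    have "inj F"
    proof (rule injI, rule ccontr)
      fix t u assume "F t = F u" "t \<noteq> u"
      moreover have "F u \<in> subalgebra hull (F ` {u})" by (rule hull_inc) simp
      ultimately show False using not_in[of t "{u}"] by simp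
    qed
    then have "range F \<approx> (UNIV :: nat set set)" by (rule inj_on_image_eqpoll_self)
    then show ?thesis using nat_sets_eqpoll_reals eqpoll_trans by blast
  qed
  ultimately show ?thesis unfolding algebrable_def using alg CA by blast
qed

section \<open>Analytic and ultradifferentiable germs\<close>

lemma nderiv_cong_open:
  assumes U: "open U" and eq: "\<And>x. x \<in> U \<Longrightarrow> f x = g x" and x: "x \<in> U"
  shows "nderiv j f x = nderiv j g x"
  using x
proof (induction j arbitrary: x)
  case 0 then show ?case using eq by simp
next
  case (Suc j)
  have "\<forall>\<^sub>F y in nhds x. nderiv j f y = nderiv j g y"
    using eventually_nhds_in_open[OF U Suc.prems] by (rule eventually_mono) (rule Suc.IH)
  then show ?case unfolding nderiv_Suc by (intro vector_derivative_cong_eq) (auto elim: eventually_mono)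
qed

lemma nderiv_unique:
  assumes U: "open U" and f0: "\<And>x. x \<in> U \<Longrightarrow> f x = g 0 x"
    and der: "\<And>j x. x \<in> U \<Longrightarrow> (g j has_vector_derivative g (Suc j) x) (at x)" and x: "x \<in> U"
  shows "nderiv j f x = g j x" "nderiv j f differentiable (at x)"
proof -
  have eq: "nderiv j f x = g j x" if "x \<in> U" for j x
    using that
  proof (induction j arbitrary: x)
    case 0 then show ?case using f0 by simp
  next
    case (Suc j)
    have "(nderiv j f has_vector_derivative g (Suc j) x) (at x)"
      by (rule has_vector_derivative_transform_within_open[OF der U]) (use Suc in auto)
    then show ?case by (simp add: nderiv_Suc vector_derivative_at)
  qed
  then show "nderiv j f x = g j x" using x .
  have "(nderiv j f has_vector_derivative g (Suc j) x) (at x)"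
    by (rule has_vector_derivative_transform_within_open[OF der U]) (use x eq in auto)
  then show "nderiv j f differentiable (at x)" by (rule differentiableI_vector)
qed

lemma germ_of_eq_iff: "germ_of f = germ_of g \<longleftrightarrow> germ_eq f g"
  by transfer (rule refl)

lemma germ_eqE:
  assumes "germ_eq f g"
  obtains e where "0 < e" "\<And>x. \<bar>x\<bar> < e \<Longrightarrow> f x = g x"
  using assms by (auto simp: germ_eq_def eventually_nhds_metric dist_real_def)

text \<open>The power series extends \<open>f\<close> to a holomorphic function on the complex disc
  of radius \<open>r\<close>. It is bounded on the closed disc of radius \<open>r / 2\<close>, which
  contains the discs of radius \<open>r / 4\<close> about all \<open>x\<close> with
  \<open>\<bar>x\<bar> < r / 4\<close>; Cauchy's inequality there gives
  \<open>\<rho> = 4 / r\<close>.\<close>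

lemma power_series_nderiv_bound:
  assumes r: "0 < r" and f: "\<And>y. \<bar>y\<bar> < r \<Longrightarrow> (\<lambda>n. a n * of_real y ^ n) sums f y"
  obtains B \<rho> where "0 < B" "0 < \<rho>"
    "\<And>j x. \<bar>x\<bar> < r / 4 \<Longrightarrow> nderiv j f differentiable (at x)"
    "\<And>j x. \<bar>x\<bar> < r / 4 \<Longrightarrow> norm (nderiv j f x) \<le> B * \<rho> ^ j * fact j"
proof -
  define F where "F z = (\<Sum>n. a n * z ^ n)" for z :: complex
  have sums: "(\<lambda>n. a n * (w - 0) ^ n) sums F w" if "w \<in> ball 0 r" for w
  proof -
    have "norm w < r" using that by simp
    then obtain y where y: "norm w < y" "y < r" using dense by blast
    then have "0 \<le> y" using norm_ge_zero[of w] by linarith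
    have "summable (\<lambda>n. a n * of_real y ^ n)" using f[of y] y \<open>0 \<le> y\<close> by (auto simp: sums_iff)
    then have "summable (\<lambda>n. a n * w ^ n)" by (rule powser_inside) (use y \<open>0 \<le> y\<close> in simp)
    then show ?thesis by (simp add: F_def summable_sums)
  qed
  have hol: "F holomorphic_on ball 0 r" by (rule power_series_holomorphic[OF sums])
  have fF: "f y = F (of_real y)" if "\<bar>y\<bar> < r" for y
    using f[OF that] by (simp add: F_def sums_iff)
  have der: "((\<lambda>x. (deriv ^^ j) F (of_real x)) has_vector_derivative (deriv ^^ Suc j) F (of_real x)) (at x)"
    if "x \<in> ball 0 r" for j and x :: real
  proof (rule has_vector_derivative_real_field)
    have "(deriv ^^ j) F holomorphic_on ball 0 r" using hol by (intro holomorphic_higher_deriv) auto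
    then show "((deriv ^^ j) F has_field_derivative (deriv ^^ Suc j) F (of_real x)) (at (of_real x))"
      unfolding funpow.simps o_apply by (rule holomorphic_derivI) (use that in auto)
  qed
  have f0: "f x = (deriv ^^ 0) F (of_real x)" if "x \<in> ball 0 r" for x
    using fF that by simp
  note nd = nderiv_unique[where g = "\<lambda>j x. (deriv ^^ j) F (of_real x)", OF open_ball[of 0 r] f0 der]
  have "compact (F ` cball 0 (r / 2))"
    using r hol by (intro compact_continuous_image continuous_on_subset[OF holomorphic_on_imp_continuous_on])
      auto
  then obtain B where B: "0 < B" "\<And>z. z \<in> cball 0 (r / 2) \<Longrightarrow> norm (F z) \<le> B"
    by (auto dest!: compact_imp_bounded simp: bounded_pos)
  show thesis
  proof
    show "0 < B" "0 < 4 / r" using B r by auto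
    show "nderiv j f differentiable (at x)" if "\<bar>x\<bar> < r / 4" for j x
      using r that by (intro nd(2)) auto
    show "norm (nderiv j f x) \<le> B * (4 / r) ^ j * fact j" if x: "\<bar>x\<bar> < r / 4" for j x
    proof -
      have sub: "cball (of_real x) (r / 4) \<subseteq> cball (0 :: complex) (r / 2)"
        using x by (intro cball_subset_cball_iff[THEN iffD2]) (auto simp: dist_norm)
      also have "\<dots> \<subseteq> ball 0 r" using r by auto
      finally have sub': "cball (of_real x) (r / 4) \<subseteq> ball (0 :: complex) r" .
      have "norm ((deriv ^^ j) F (of_real x)) \<le> fact j * B / (r / 4) ^ j"
      proof (rule Cauchy_inequality)
        show "F holomorphic_on ball (of_real x) (r / 4)"
          using holomorphic_on_subset[OF hol] sub' ball_subset_cball by blast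
        show "continuous_on (cball (of_real x) (r / 4)) F"
          using continuous_on_subset[OF holomorphic_on_imp_continuous_on[OF hol] sub'] .
        show "0 < r / 4" using r by simp
        show "norm (F z) \<le> B" if "norm (of_real x - z) = r / 4" for z
          using sub that by (intro B(2)) (auto simp: dist_norm)
      qed
      then show ?thesis using nd(1)[of x j] x r by (simp add: power_divide mult_ac)
    qed
  qed
qed

text \<open>The expansion at 0 of an analytic representative \<open>g\<close>, restricted to the
  interval where \<open>f\<close> agrees with \<open>g\<close>, makes the estimate available for an
  arbitrary representative \<open>f\<close>.\<close>

lemma analytic_germ_bound:
  assumes "germ_of f \<in> analytic_germs"
  obtains B \<rho> \<delta> where "0 < B" "0 < \<rho>" "0 < \<delta>"
    "\<And>j x. \<bar>x\<bar> < \<delta> \<Longrightarrow> nderiv j f differentiable (at x)"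
    "\<And>j x. \<bar>x\<bar> < \<delta> \<Longrightarrow> norm (nderiv j f x) \<le> B * \<rho> ^ j * fact j"
proof -
  obtain k :: nat and g where k: "k \<ge> 1"
    and g: "g \<in> real_analytic_functions {- (1 / real k)<..<1 / real k}" and fg: "germ_eq f g"
    using assms by (auto simp: analytic_germs_def germs_at_0_def germ_of_eq_iff)
  have "0 \<in> {- (1 / real k)<..<1 / real k}" using k by simp
  then obtain r a where ra: "0 < r" "\<And>y. \<bar>y - 0\<bar> < r \<Longrightarrow> (\<lambda>n. a n * of_real (y - 0) ^ n) sums g y"
    using g unfolding real_analytic_functions_def by blast
  obtain e where e: "0 < e" "\<And>x. \<bar>x\<bar> < e \<Longrightarrow> f x = g x" by (rule germ_eqE[OF fg]) blast
  obtain B \<rho> where "0 < B" "0 < \<rho>"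
    "\<And>j x. \<bar>x\<bar> < min r e / 4 \<Longrightarrow> nderiv j f differentiable (at x)"
    "\<And>j x. \<bar>x\<bar> < min r e / 4 \<Longrightarrow> norm (nderiv j f x) \<le> B * \<rho> ^ j * fact j"
  proof (rule power_series_nderiv_bound[of "min r e" a f])
    show "(\<lambda>n. a n * of_real y ^ n) sums f y" if "\<bar>y\<bar> < min r e" for y
      using ra(2)[of y] e(2)[of y] that by simp
  qed (use ra e in auto)
  then show thesis using that[of B \<rho> "min r e / 4"] ra e by auto
qed

section \<open>Classes that contain the analytic germs\<close>

text \<open>Common frame for both inclusions, which are thereby reduced to comparing
  \<open>\<rho> ^ j * fact j\<close> with \<open>N j\<close>.\<close>

lemma analytic_germs_subset:
  assumes X: "\<And>U f B \<rho>. \<lbrakk>0 < B; 0 < \<rho>; \<And>j x. x \<in> U \<Longrightarrow> nderiv j f differentiable (at x);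
      \<And>j x. x \<in> U \<Longrightarrow> norm (nderiv j f x) \<le> B * \<rho> ^ j * fact j\<rbrakk> \<Longrightarrow> f \<in> X U"
  shows "analytic_germs \<subseteq> germs_at_0 X"
proof
  fix G assume G: "G \<in> analytic_germs"
  then obtain f where f: "G = germ_of f" by (auto simp: analytic_germs_def germs_at_0_def)
  obtain B \<rho> \<delta> where b: "0 < B" "0 < \<rho>" "0 < \<delta>"
    "\<And>j x. \<bar>x\<bar> < \<delta> \<Longrightarrow> nderiv j f differentiable (at x)"
    "\<And>j x. \<bar>x\<bar> < \<delta> \<Longrightarrow> norm (nderiv j f x) \<le> B * \<rho> ^ j * fact j"
    using analytic_germ_bound G f by blast
  obtain k :: nat where k: "1 / \<delta> < real k" using reals_Archimedean2 by blast
  then have "0 < real k" using b(3) by (meson divide_pos_pos less_trans zero_less_one)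
  then have k': "k \<ge> 1" "1 / real k < \<delta>" using k b(3) by (auto simp: field_simps)
  have "f \<in> X {- (1 / real k)<..<1 / real k}"
    by (rule X[OF b(1,2)]) (use b(4,5) k' in auto)
  then show "G \<in> germs_at_0 X" unfolding germs_at_0_def f using k' by auto
qed

lemma analytic_germs_subset_roumieu:
  assumes N: "\<And>j. 0 < N j" and c: "0 < c" "0 < \<delta>" "\<And>j. c * \<delta> ^ j * fact j \<le> N j"
  shows "analytic_germs \<subseteq> roumieu_germs N"
  unfolding roumieu_germs_def
proof (rule analytic_germs_subset)
  fix U f B and \<rho> :: real
  assume *: "0 < B" "0 < \<rho>" "\<And>j x. x \<in> U \<Longrightarrow> nderiv j f differentiable (at x)"
    "\<And>j x. x \<in> U \<Longrightarrow> norm (nderiv j f x) \<le> B * \<rho> ^ j * fact j"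
  have "norm (nderiv j f x) \<le> B / c * ((\<rho> / \<delta>) ^ j * N j)" if "x \<in> U" for j x
  proof -
    have "B / c * (\<rho> / \<delta>) ^ j * (c * \<delta> ^ j * fact j) \<le> B / c * (\<rho> / \<delta>) ^ j * N j"
      using * c by (intro mult_left_mono) auto
    then show ?thesis using *(4)[OF that, of j] c(1,2) by (simp add: power_divide)
  qed
  then have "ultradiff_bound N K (\<rho> / \<delta>) f" if "K \<subseteq> U" for K
    using that * c by (subst ultradiff_bound_iff[OF _ N]) (auto intro!: exI[of _ "B / c"])
  then show "f \<in> roumieu_functions N U"
    using * c by (auto simp: roumieu_functions_def smooth_functions_def intro!: exI[of _ "\<rho> / \<delta>"])
qed

lemma analytic_germs_subset_beurling:
  assumes N: "\<And>j. 0 < N j" and c: "\<And>\<delta>. 0 < \<delta> \<Longrightarrow> \<exists>c>0. \<forall>j. c * \<delta> ^ j * fact j \<le> N j"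
  shows "analytic_germs \<subseteq> beurling_germs N"
  unfolding beurling_germs_def
proof (rule analytic_germs_subset)
  fix U f B and \<rho> :: real
  assume *: "0 < B" "0 < \<rho>" "\<And>j x. x \<in> U \<Longrightarrow> nderiv j f differentiable (at x)"
    "\<And>j x. x \<in> U \<Longrightarrow> norm (nderiv j f x) \<le> B * \<rho> ^ j * fact j"
  have "ultradiff_bound N K h f" if K: "K \<subseteq> U" and h: "0 < h" for K h
    unfolding ultradiff_bound_iff[OF h N]
  proof -
    \<comment> \<open>The lower bound for \<open>N\<close> at \<open>\<delta> = \<rho> / h\<close>
      trades \<open>\<rho>\<close> for the prescribed \<open>h\<close>.\<close>
    obtain c where c: "0 < c" "\<And>j. c * (\<rho> / h) ^ j * fact j \<le> N j" using c[of "\<rho> / h"] * h by auto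
    have "norm (nderiv j f x) \<le> B / c * (h ^ j * N j)" if "x \<in> K" for j x
    proof -
      have "B / c * h ^ j * (c * (\<rho> / h) ^ j * fact j) \<le> B / c * h ^ j * N j"
        using * c h by (intro mult_left_mono) auto
      then show ?thesis using *(4)[of x j] K that c(1) h by (auto simp: power_divide)
    qed
    then show "\<exists>C. \<forall>j. \<forall>x\<in>K. norm (nderiv j f x) \<le> C * (h ^ j * N j)" by blast
  qed
  then show "f \<in> beurling_functions N U"
    using * by (auto simp: beurling_functions_def smooth_functions_def)
qed

section \<open>A nonanalytic germ in the Beurling class\<close>

text \<open>The Weierstrass test makes the series of derivatives converge uniformly, which permits
  termwise differentiation.\<close>

lemma has_vector_derivative_suminf:
  fixes f :: "nat \<Rightarrow> real \<Rightarrow> 'a::banach"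
  assumes der: "\<And>n x. (f n has_vector_derivative f' n x) (at x)"
    and bnd: "\<And>n x. norm (f' n x) \<le> u n" and u: "summable u" and f: "\<And>x. summable (\<lambda>n. f n x)"
  shows "((\<lambda>x. \<Sum>n. f n x) has_vector_derivative (\<Sum>n. f' n x)) (at x)"
proof -
  define g' where "g' x = (\<Sum>n. f' n x)" for x
  have unif: "uniform_limit UNIV (\<lambda>n x. \<Sum>i<n. f' i x) g' sequentially"
    unfolding g'_def[abs_def] using bnd u by (intro Weierstrass_m_test) auto
  have "\<exists>g. \<forall>x\<in>UNIV. (\<lambda>n. f n x) sums g x \<and> (g has_derivative (\<lambda>h. h *\<^sub>R g' x)) (at x within UNIV)"
  proof (rule has_derivative_series[where f' = "\<lambda>n x h. h *\<^sub>R f' n x"])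
    show "(f n has_derivative (\<lambda>h. h *\<^sub>R f' n x)) (at x within UNIV)" for n x
      using der[of n x] by (simp add: has_vector_derivative_def)
    show "\<forall>\<^sub>F n in sequentially. \<forall>x\<in>UNIV. \<forall>h. norm ((\<Sum>i<n. h *\<^sub>R f' i x) - h *\<^sub>R g' x) \<le> e * norm h"
      if "0 < e" for e
      using uniform_limitD[OF unif that]
    proof eventually_elim
      case (elim n)
      have "norm ((\<Sum>i<n. h *\<^sub>R f' i x) - h *\<^sub>R g' x) \<le> e * norm h" for x h
      proof -
        have "norm ((\<Sum>i<n. h *\<^sub>R f' i x) - h *\<^sub>R g' x) = norm h * norm ((\<Sum>i<n. f' i x) - g' x)"
          by (simp flip: scaleR_sum_right scaleR_diff_right)
        also have "\<dots> \<le> norm h * e"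
          using elim by (intro mult_left_mono) (auto simp: dist_norm less_imp_le)
        finally show ?thesis by (simp add: mult.commute)
      qed
      then show ?case by blast
    qed
    show "(\<lambda>n. f n 0) sums (\<Sum>n. f n 0)" using f by (rule summable_sums)
  qed auto
  then obtain g where g: "\<And>x. (\<lambda>n. f n x) sums g x" "\<And>x. (g has_derivative (\<lambda>h. h *\<^sub>R g' x)) (at x)"
    by auto
  have "g = (\<lambda>x. \<Sum>n. f n x)" using g(1) by (simp add: fun_eq_iff sums_iff)
  then show ?thesis using g(2) by (simp add: has_vector_derivative_def g'_def)
qed

text \<open>The finitely many indices before the bound sets in are absorbed by \<open>c\<close>, a
  minimum of positive quotients.\<close>

lemma eventually_root_lower_bound:
  assumes pos: "\<And>j. 0 < N j" and \<delta>: "0 < \<delta>"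
    and ev: "\<forall>\<^sub>F j in sequentially. \<delta> \<le> root j (over_fact N j)"
  shows "\<exists>c>0. \<forall>j. c * \<delta> ^ j * fact j \<le> N j"
proof -
  obtain J where J: "\<And>j. j \<ge> J \<Longrightarrow> \<delta> \<le> root j (over_fact N j)"
    using ev by (auto simp: eventually_sequentially)
  define r where "r j = N j / (\<delta> ^ j * fact j)" for j
  have r0: "0 < r j" for j using pos \<delta> by (simp add: r_def)
  \<comment> \<open>Starting at \<open>Suc J\<close> keeps \<open>j = 0\<close> out, where
    \<open>root 0\<close> is 0 and does not invert the power.\<close>
  have big: "1 \<le> r j" if "j \<ge> Suc J" for j
  proof -
    have "\<delta> ^ j \<le> root j (over_fact N j) ^ j" using J[of j] \<delta> that by (intro power_mono) auto
    also have "\<dots> = over_fact N j" using that pos[of j] by (simp add: over_fact_def)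
    finally show ?thesis using \<delta> by (simp add: r_def over_fact_def field_simps)
  qed
  define c where "c = Min (insert 1 (r ` {..J}))"
  have "c * \<delta> ^ j * fact j \<le> N j" for j
  proof -
    have "c \<le> r j"
    proof (cases "j \<le> J")
      case True then show ?thesis unfolding c_def by (intro Min_le) auto
    next
      case False
      have "c \<le> 1" unfolding c_def by (intro Min_le) auto
      then show ?thesis using big[of j] False by simp
    qed
    then show ?thesis using \<delta> by (simp add: r_def field_simps)
  qed
  moreover have "0 < c" unfolding c_def using r0 by (subst Min_gr_iff) auto
  ultimately show ?thesis by blast
qed

lemma weight_sequence_lower_bound:
  assumes "weight_sequence N"
  obtains c \<delta> where "0 < c" "0 < \<delta>" "\<And>j. c * \<delta> ^ j * fact j \<le> N j"
proof -
  have "0 < liminf (\<lambda>j. ereal (root j (over_fact N j)))" using assms by (simp add: weight_sequence_def)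
  then obtain z where z: "0 < z" "z < liminf (\<lambda>j. ereal (root j (over_fact N j)))" using dense by blast
  then obtain \<delta> where \<delta>: "z = ereal \<delta>" "0 < \<delta>" by (cases z) auto
  have "\<forall>\<^sub>F j in sequentially. \<delta> \<le> root j (over_fact N j)"
    using less_LiminfD[OF z(2)] by eventually_elim (simp add: \<delta>(1))
  from eventually_root_lower_bound[OF weight_sequence_pos[OF assms] \<delta>(2) this]
  show thesis using that \<delta>(2) by blast
qed

text \<open>A lacunary sum of exponentials \<open>a k * exp (\<i> * \<nu> k * x)\<close>. With frequency \<open>\<mu> (p k)\<close>, log-convexity
  keeps the derivatives of each term below \<open>N\<close> with equality in order \<open>p k\<close>; dividing the frequency
  by \<open>Suc k\<close> moves the sum from the Roumieu to the Beurling class.\<close>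

lemma nonanalytic_beurling_function:
  assumes N: "weight_sequence N" and unb: "\<And>B m. \<exists>j\<ge>m. B ^ j \<le> over_fact N j"
  obtains f where "\<And>j x. nderiv j f differentiable (at x)"
    "\<And>h K. 0 < h \<Longrightarrow> ultradiff_bound N K h f" "germ_of f \<notin> analytic_germs"
proof -
  note pos = weight_sequence_pos[OF N]
  define \<mu> where "\<mu> p = N (Suc p) / N p" for p
  have \<mu>0: "0 < \<mu> p" for p using pos by (simp add: \<mu>_def)
  have tangent: "N p * \<mu> p ^ j / \<mu> p ^ p \<le> N j" for p j
    using weight_sequence_tangent[OF N, of p j] \<mu>0[of p] by (simp add: \<mu>_def[symmetric] pos_divide_le_eq)
  \<comment> \<open>Of the two factors \<open>real (Suc k) ^ p\<close>, one pays for the division of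
    the frequency and the other will outgrow \<open>\<rho> ^ p\<close>. Of \<open>4 ^ p\<close>, one
    factor \<open>2 ^ p\<close> absorbs the weight \<open>(1/2) ^ k\<close>, as
    \<open>k \<le> p\<close>, and the other will exceed \<open>B\<close>.\<close>
  have "\<exists>p\<ge>k. (4 * real (Suc k) ^ 2) ^ p \<le> over_fact N p" for k using unb by blast
  then obtain p where p: "\<And>k. k \<le> p k" "\<And>k. (4 * real (Suc k) ^ 2) ^ p k \<le> over_fact N (p k)" by metis
  define \<nu> where "\<nu> k = \<mu> (p k) / real (Suc k)" for k
  define a where "a k = (1/2) ^ k * N (p k) / \<mu> (p k) ^ p k" for k
  \<comment> \<open>The modulus of the \<open>j\<close>-th derivative of the \<open>k\<close>-th
    exponential, the same at every point.\<close>
  define u where "u j k = a k * \<nu> k ^ j" for j k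
  have \<nu>0: "0 < \<nu> k" and a0: "0 < a k" for k using \<mu>0 pos by (simp_all add: \<nu>_def a_def)
  have u0: "0 < u j k" for j k using \<nu>0 a0 by (simp add: u_def)
  have u_le: "u j k \<le> (1/2) ^ k * (N j / real (Suc k) ^ j)" for j k
  proof -
    have "u j k = (1/2) ^ k * ((N (p k) * \<mu> (p k) ^ j / \<mu> (p k) ^ p k) / real (Suc k) ^ j)"
      by (simp add: u_def a_def \<nu>_def power_divide del: of_nat_Suc)
    also have "\<dots> \<le> (1/2) ^ k * (N j / real (Suc k) ^ j)"
      by (intro mult_left_mono divide_right_mono tangent) auto
    finally show ?thesis .
  qed
  have summable_u: "summable (u j)" for j
  proof (rule summable_comparison_test')
    show "summable (\<lambda>k. (1/2) ^ k * N j :: real)" by (intro summable_mult2 summable_geometric) simp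
    show "norm (u j k) \<le> (1/2) ^ k * N j" for k
    proof -
      have "N j / real (Suc k) ^ j \<le> N j / 1" using pos[of j] by (intro divide_left_mono) auto
      then have "(1/2) ^ k * (N j / real (Suc k) ^ j) \<le> (1/2) ^ k * N j" by (intro mult_left_mono) auto
      then show ?thesis using u_le[of j k] u0[of j k] by simp
    qed
  qed
  define S where "S j = (\<Sum>k. u j k)" for j
  define t where "t j k x = of_real (a k) * (\<i> * of_real (\<nu> k)) ^ j * exp (\<i> * of_real (\<nu> k * x))" for j k and x :: real
  have norm_t: "norm (t j k x) = u j k" for j k x
    using \<nu>0[of k] a0[of k] by (simp add: t_def u_def norm_mult norm_power)
  have summable_t: "summable (\<lambda>k. t j k x)" for j x
    by (rule summable_norm_cancel) (simp add: norm_t summable_u)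
  define g where "g j x = (\<Sum>k. t j k x)" for j x
  define f where "f = g 0"
  have der: "(g j has_vector_derivative g (Suc j) x) (at x)" for j x
    unfolding g_def[abs_def]
  proof (rule has_vector_derivative_suminf[where u = "u (Suc j)"])
    show "(t j k has_vector_derivative t (Suc j) k x) (at x)" for k x
    proof -
      have "((\<lambda>z. of_real (a k) * (\<i> * of_real (\<nu> k)) ^ j * exp (\<i> * (of_real (\<nu> k) * z)))
          has_field_derivative t (Suc j) k x) (at (of_real x))"
        by (auto intro!: derivative_eq_intros simp: t_def)
      from has_vector_derivative_real_field[OF this] show ?thesis by (simp add: t_def[abs_def])
    qed
  qed (simp_all add: norm_t summable_u summable_t)
  have nd: "nderiv j f x = g j x" "nderiv j f differentiable (at x)" for j x
    using nderiv_unique[OF open_UNIV, of f g] der by (auto simp: f_def)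
  have norm_g: "norm (g j x) \<le> S j" for j x
    unfolding g_def S_def using summable_norm[of "\<lambda>k. t j k x"] by (simp add: norm_t summable_u)
  have S_ge: "u j k \<le> S j" for j k
    unfolding S_def using sum_le_suminf[OF summable_u, of "{k}" j] u0 by (simp add: less_imp_le)
  \<comment> \<open>At 0 all terms of the \<open>j\<close>-th derivative have the same argument
    \<open>\<i> ^ j\<close>, so nothing cancels and each single \<open>u j k\<close> is a lower
    bound.\<close>
  have norm_g0: "norm (g j 0) = S j" for j
  proof -
    have "g j 0 = (\<Sum>k. \<i> ^ j * of_real (u j k))"
      by (simp add: g_def t_def u_def power_mult_distrib mult_ac)
    also have "\<dots> = \<i> ^ j * (\<Sum>k. of_real (u j k))"
      by (intro suminf_mult summable_of_real summable_u)
    also have "(\<Sum>k. of_real (u j k)) = (of_real (S j) :: complex)"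
      unfolding S_def by (rule suminf_of_real[OF summable_u, symmetric])
    finally show ?thesis using S_ge[of j 0] u0[of j 0] by (simp add: norm_mult norm_power)
  qed
  show thesis
  proof
    show "nderiv j f differentiable (at x)" for j x by (rule nd)
    show "ultradiff_bound N K h f" if h: "0 < h" for h K
    proof -
      obtain c \<delta> where c: "0 < c" "0 < \<delta>" "\<And>j. c * \<delta> ^ j * fact j \<le> N j"
        using weight_sequence_lower_bound[OF N] by blast
      obtain K0 :: nat where K0: "1 / h \<le> real K0" using real_arch_simple by blast
      \<comment> \<open>Constants for the finitely many \<open>k < K0\<close>. A single exponential
        has derivatives growing like \<open>\<nu> k ^ j\<close>, which one term of the exponential
        series compares with \<open>(h * \<delta>) ^ j * fact j\<close> and hence with
        \<open>h ^ j * N j\<close>.\<close>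
      define E where "E k = a k / c * exp (\<nu> k / (h * \<delta>))" for k
      have low: "u j k \<le> E k * (h ^ j * N j)" for j k
      proof -
        have "(\<nu> k / (h * \<delta>)) ^ j / fact j \<le> exp (\<nu> k / (h * \<delta>))"
        proof -
          have "(\<Sum>i\<in>{j}. (\<nu> k / (h * \<delta>)) ^ i / fact i) \<le> (\<Sum>i. (\<nu> k / (h * \<delta>)) ^ i / fact i)"
            using summable_exp[of "\<nu> k / (h * \<delta>)"] \<nu>0[of k] h c
            by (intro sum_le_suminf) (auto simp: field_simps)
          then show ?thesis by (simp add: exp_def divide_inverse_commute)
        qed
        then have "\<nu> k ^ j \<le> exp (\<nu> k / (h * \<delta>)) * (h ^ j * (\<delta> ^ j * fact j))"
          using h c by (simp add: power_divide power_mult_distrib pos_divide_le_eq mult_ac)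
        also have "\<dots> \<le> exp (\<nu> k / (h * \<delta>)) * (h ^ j * (N j / c))"
          using h c by (intro mult_left_mono) (auto simp: pos_le_divide_eq mult_ac)
        finally have "a k * \<nu> k ^ j \<le> a k * (exp (\<nu> k / (h * \<delta>)) * (h ^ j * (N j / c)))"
          using a0[of k] by (intro mult_left_mono) auto
        then show ?thesis by (simp add: u_def E_def mult_ac)
      qed
      \<comment> \<open>From \<open>K0\<close> on the division of the frequency by
        \<open>Suc k\<close> already supplies \<open>h ^ j\<close>, and the weights
        \<open>(1/2) ^ k\<close> remain for summation.\<close>
      have high: "u j k \<le> (1/2) ^ k * (h ^ j * N j)" if "k \<ge> K0" for j k
      proof -
        have "1 / h \<le> real (Suc k)" using K0 that by simp
        then have "1 / real (Suc k) \<le> h" using h by (simp add: field_simps)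
        then have "(1 / real (Suc k)) ^ j \<le> h ^ j" by (intro power_mono) auto
        then have "(1/2) ^ k * ((1 / real (Suc k)) ^ j * N j) \<le> (1/2) ^ k * (h ^ j * N j)"
          using pos[of j] by (intro mult_left_mono mult_right_mono) auto
        then show ?thesis using u_le[of j k] by (simp add: power_divide del: of_nat_Suc)
      qed
      define D where "D k = (if k < K0 then E k else (1/2) ^ k)" for k
      have "summable (\<lambda>k. (1/2) ^ k :: real)" by (rule summable_geometric) simp
      then have sD: "summable D"
        by (rule summable_cong[THEN iffD2, rotated])
          (auto simp: D_def eventually_sequentially intro!: exI[of _ K0])
      have "S j \<le> (\<Sum>k. D k) * (h ^ j * N j)" for j
        unfolding S_def suminf_mult2[OF sD]
        using low high by (intro suminf_le summable_u summable_mult2 sD) (auto simp: D_def)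
      then have "norm (nderiv j f x) \<le> (\<Sum>k. D k) * (h ^ j * N j)" for j x
        using order_trans[OF norm_g] by (simp add: nd)
      then show ?thesis
        by (intro ultradiff_bound_iff[THEN iffD2] h pos exI[of _ "\<Sum>k. D k"]) blast
    qed
    show "germ_of f \<notin> analytic_germs"
    proof
      assume "germ_of f \<in> analytic_germs"
      then obtain B \<rho> \<delta> where b: "0 < B" "0 < \<rho>" "0 < \<delta>"
        "\<And>j x. \<bar>x\<bar> < \<delta> \<Longrightarrow> norm (nderiv j f x) \<le> B * \<rho> ^ j * fact j"
        by (rule analytic_germ_bound) blast
      obtain k :: nat where k: "B + \<rho> \<le> real k" using real_arch_simple by blast
      define j where "j = p k"
      have "(2 * real (Suc k)) ^ j * fact j \<le> u j k"
      proof -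
        have "(2 * real (Suc k)) ^ j = (1/2) ^ j * (4 * real (Suc k) ^ 2) ^ j / real (Suc k) ^ j"
          by (subst power_mult_distrib[symmetric], subst power_divide[symmetric])
            (simp add: power2_eq_square del: of_nat_Suc)
        also have "\<dots> \<le> (1/2) ^ k * over_fact N j / real (Suc k) ^ j"
          using p[of k] by (intro divide_right_mono mult_mono power_decreasing) (auto simp: j_def)
        finally have "(2 * real (Suc k)) ^ j * fact j \<le> (1/2) ^ k * N j / real (Suc k) ^ j"
          by (simp add: over_fact_def field_simps del: of_nat_Suc)
        also have "\<dots> = u j k"
          using \<mu>0[of j] by (simp add: u_def a_def \<nu>_def j_def power_divide del: of_nat_Suc)
        finally show ?thesis .
      qed
      also have "u j k \<le> norm (nderiv j f 0)" using S_ge norm_g0 by (simp add: nd)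
      also have "\<dots> \<le> B * \<rho> ^ j * fact j" using b by simp
      finally have "2 ^ j * real (Suc k) ^ j \<le> B * \<rho> ^ j" by (simp add: power_mult_distrib del: of_nat_Suc)
      moreover have "\<rho> ^ j \<le> real (Suc k) ^ j" using b k by (intro power_mono) auto
      then have "2 ^ j * \<rho> ^ j \<le> 2 ^ j * real (Suc k) ^ j" by (rule mult_left_mono) simp
      moreover have "B < 2 ^ j"
      proof -
        have "B \<le> real j" using b k p(1)[of k] by (simp add: j_def)
        also have "\<dots> < 2 ^ j" by simp
        finally show ?thesis .
      qed
      then have "B * \<rho> ^ j < 2 ^ j * \<rho> ^ j" using b by simp
      ultimately show False by linarith
    qed
  qed
qed

text \<open>Beurling germs are Roumieu germs, so this one germ witnesses strictness of the inclusion
  in both cases.\<close>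

lemma nonanalytic_beurling_germ:
  assumes N: "weight_sequence N" and unb: "\<And>B m. \<exists>j\<ge>m. B ^ j \<le> over_fact N j"
  obtains G where "G \<in> beurling_germs N" "G \<notin> analytic_germs"
proof -
  obtain f where f: "\<And>j x. nderiv j f differentiable (at x)"
    "\<And>h K. 0 < h \<Longrightarrow> ultradiff_bound N K h f" "germ_of f \<notin> analytic_germs"
    by (rule nonanalytic_beurling_function[OF N unb]) blast
  have "f \<in> beurling_functions N {- (1 / real 1)<..<1 / real 1}"
    using f by (simp add: beurling_functions_def smooth_functions_def)
  then have "germ_of f \<in> beurling_germs N" unfolding beurling_germs_def germs_at_0_def by blast
  then show thesis using that f(3) by blast
qed

section \<open>Analyticity from factorial bounds on the derivatives\<close>

text \<open>Differentiation with respect to the centre \<open>t\<close> telescopes, and only the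
  last term remains.\<close>

lemma has_vector_derivative_taylor_sum:
  fixes f :: "nat \<Rightarrow> real \<Rightarrow> 'a::real_normed_vector"
  assumes der: "\<And>j. (f j has_vector_derivative f (Suc j) t) (at t)"
  shows "((\<lambda>t. \<Sum>i\<le>n. ((y - t) ^ i / fact i) *\<^sub>R f i t) has_vector_derivative
    ((y - t) ^ n / fact n) *\<^sub>R f (Suc n) t) (at t)"
proof (induction n)
  case 0 then show ?case using der by simp
next
  case (Suc n)
  have "((\<lambda>t. (y - t) ^ Suc n / fact (Suc n)) has_real_derivative - ((y - t) ^ n / fact n)) (at t)"
    using DERIV_cdivide[OF DERIV_chain'[OF DERIV_diff[OF DERIV_const DERIV_ident] DERIV_pow[of "Suc n"]],
        of y "fact (Suc n)" t UNIV] by (simp del: of_nat_Suc)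
  from has_vector_derivative_add[OF Suc has_vector_derivative_scaleR[OF this der[of "Suc n"]]]
  show ?case by (simp del: of_nat_Suc)
qed

text \<open>The mean value inequality applied to the Taylor sum as a function of its centre.\<close>

lemma taylor_remainder_bound:
  fixes f :: "nat \<Rightarrow> real \<Rightarrow> 'a::real_normed_vector"
  assumes der: "\<And>j t. t \<in> closed_segment x y \<Longrightarrow> (f j has_vector_derivative f (Suc j) t) (at t)"
    and bnd: "\<And>t. t \<in> closed_segment x y \<Longrightarrow> norm (f (Suc n) t) \<le> B"
  shows "norm (f 0 y - (\<Sum>i\<le>n. ((y - x) ^ i / fact i) *\<^sub>R f i x)) \<le> \<bar>y - x\<bar> ^ Suc n / fact n * B"
proof -
  define \<phi> where "\<phi> t = (\<Sum>i\<le>n. ((y - t) ^ i / fact i) *\<^sub>R f i t)" for t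
  have "norm (\<phi> y - \<phi> x) \<le> (\<bar>y - x\<bar> ^ n / fact n * B) * norm (y - x)"
  proof (rule differentiable_bound[of "closed_segment x y"])
    show "(\<phi> has_derivative (\<lambda>h. h *\<^sub>R ((y - t) ^ n / fact n) *\<^sub>R f (Suc n) t)) (at t within closed_segment x y)"
      if "t \<in> closed_segment x y" for t
      using has_vector_derivative_taylor_sum[of f t y n] der[OF that]
      unfolding \<phi>_def[abs_def] has_vector_derivative_def by (auto intro: has_derivative_at_withinI)
    show "onorm (\<lambda>h. h *\<^sub>R ((y - t) ^ n / fact n) *\<^sub>R f (Suc n) t) \<le> \<bar>y - x\<bar> ^ n / fact n * B"
      if t: "t \<in> closed_segment x y" for t
    proof (rule onorm_le)
      fix h :: real
      have "\<bar>y - t\<bar> \<le> \<bar>y - x\<bar>" using segment_bound(2)[OF t] by (simp add: abs_minus_commute)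
      then have "\<bar>y - t\<bar> ^ n / fact n * norm (f (Suc n) t) \<le> \<bar>y - x\<bar> ^ n / fact n * B"
        using bnd[OF t] by (intro mult_mono divide_right_mono power_mono) auto
      then have "norm h * (\<bar>y - t\<bar> ^ n / fact n * norm (f (Suc n) t)) \<le> norm h * (\<bar>y - x\<bar> ^ n / fact n * B)"
        by (intro mult_left_mono) auto
      then show "norm (h *\<^sub>R ((y - t) ^ n / fact n) *\<^sub>R f (Suc n) t) \<le> \<bar>y - x\<bar> ^ n / fact n * B * norm h"
        by (simp add: power_abs abs_mult mult_ac)
    qed
  qed auto
  moreover have "\<phi> y = f 0 y"
  proof -
    have "\<phi> y = (\<Sum>i\<le>n. if i = 0 then f 0 y else 0)"
      unfolding \<phi>_def by (intro sum.cong) auto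
    then show ?thesis by simp
  qed
  ultimately show ?thesis by (simp add: \<phi>_def mult_ac)
qed

text \<open>The derivatives are bounded by \<open>C * \<rho> ^ j * fact j\<close> with
  \<open>\<rho> = h * H\<close>, so the Taylor remainder tends to 0 at distance less than
  \<open>1 / \<rho>\<close> from the centre. Passing to half the interval leaves a compact set on
  which the Roumieu bound is available.\<close>

lemma roumieu_germs_subset_analytic:
  assumes N: "\<And>j. 0 < N j" and H: "0 < H" "\<And>j. N j \<le> H ^ j * fact j"
  shows "roumieu_germs N \<subseteq> analytic_germs"
proof
  fix G assume "G \<in> roumieu_germs N"
  then obtain k :: nat and f where k: "k \<ge> 1" and G: "G = germ_of f"
    and f: "f \<in> roumieu_functions N {- (1 / real k)<..<1 / real k}"
    by (auto simp: roumieu_germs_def germs_at_0_def)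
  define a where "a = 1 / (2 * real k)"
  have a: "0 < a" "a < 1 / real k" using k by (simp_all add: a_def field_simps)
  have sub: "{-a..a} \<subseteq> {- (1 / real k)<..<1 / real k}"
    using a by auto
  then obtain h where h: "0 < h" "ultradiff_bound N {-a..a} h f"
    using f by (auto simp: roumieu_functions_def)
  then obtain C where C: "\<And>j t. t \<in> {-a..a} \<Longrightarrow> norm (nderiv j f t) \<le> C * (h ^ j * N j)"
    using iffD1[OF ultradiff_bound_iff[OF h(1) N] h(2)] by blast
  define \<rho> where "\<rho> = h * H"
  have \<rho>: "0 < \<rho>" using h H by (simp add: \<rho>_def)
  have C0: "0 \<le> C"
    using order_trans[OF norm_ge_zero C[of 0 0]] a N[of 0] by (simp add: zero_le_mult_iff)
  have bnd: "norm (nderiv j f t) \<le> C * \<rho> ^ j * fact j" if "t \<in> {-a..a}" for j t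
  proof -
    have "C * (h ^ j * N j) \<le> C * (h ^ j * (H ^ j * fact j))"
      using C0 h H by (intro mult_left_mono) auto
    then show ?thesis using C[OF that, of j] by (simp add: \<rho>_def power_mult_distrib mult_ac)
  qed
  have der: "(nderiv j f has_vector_derivative nderiv (Suc j) f t) (at t)" if "t \<in> {-a..a}" for j t
    using f sub that by (intro nderiv_has_vector_derivative) (auto simp: roumieu_functions_def)
  have "f \<in> real_analytic_functions {- (1 / real (2 * k))<..<1 / real (2 * k)}"
    unfolding real_analytic_functions_def
  proof (intro CollectI ballI)
    fix x assume "x \<in> {- (1 / real (2 * k))<..<1 / real (2 * k)}"
    then have x: "\<bar>x\<bar> < a" by (auto simp: a_def)
    \<comment> \<open>The first entry keeps the segment from \<open>x\<close> to \<open>y\<close>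
      inside \<open>{-a..a}\<close>, the second makes the ratio \<open>q\<close> below smaller than
      1.\<close>
    define r where "r = min (a - \<bar>x\<bar>) (1 / \<rho>)"
    have "(\<lambda>n. nderiv n f x / fact n * of_real (y - x) ^ n) sums f y" if y: "\<bar>y - x\<bar> < r" for y
    proof -
      define q where "q = \<rho> * \<bar>y - x\<bar>"
      have "\<bar>y - x\<bar> < 1 / \<rho>" using y by (simp add: r_def)
      then have q: "0 \<le> q" "q < 1" using \<rho> by (simp_all add: q_def field_simps)
      have "\<bar>y - x\<bar> < a - \<bar>x\<bar>" using y by (simp add: r_def)
      then have "\<bar>y\<bar> < a" using abs_triangle_ineq[of "y - x" x] by simp
      then have seg: "closed_segment x y \<subseteq> {-a..a}"
        using x by (intro closed_segment_subset) auto
      \<comment> \<open>The remainder divides by \<open>fact n\<close> while the derivative bound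
        has \<open>fact (Suc n)\<close>; the extra factor \<open>Suc n\<close> is harmless against
        \<open>q ^ Suc n\<close>.\<close>
      have rem: "norm (f y - (\<Sum>i\<le>n. nderiv i f x / fact i * of_real (y - x) ^ i)) \<le>
          C * (real (Suc n) * q ^ Suc n)" for n
      proof -
        have "norm (nderiv 0 f y - (\<Sum>i\<le>n. ((y - x) ^ i / fact i) *\<^sub>R nderiv i f x)) \<le>
            \<bar>y - x\<bar> ^ Suc n / fact n * (C * \<rho> ^ Suc n * fact (Suc n))"
          using seg by (intro taylor_remainder_bound der bnd) auto
        also have "\<dots> = C * (real (Suc n) * q ^ Suc n)"
          by (simp add: q_def power_mult_distrib del: power_Suc of_nat_Suc)
        also have "(\<Sum>i\<le>n. ((y - x) ^ i / fact i) *\<^sub>R nderiv i f x) =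
            (\<Sum>i\<le>n. nderiv i f x / fact i * of_real (y - x) ^ i)"
          by (intro sum.cong) (auto simp: scaleR_conv_of_real)
        finally show ?thesis by simp
      qed
      have "(\<lambda>n. real n * q ^ n) \<longlonglongrightarrow> 0" using q by (intro powser_times_n_limit_0) simp
      then have "(\<lambda>n. real (Suc n) * q ^ Suc n) \<longlonglongrightarrow> 0" by (rule LIMSEQ_Suc)
      from tendsto_mult_right_zero[OF this, of C]
      have lim: "(\<lambda>n. f y - (\<Sum>i\<le>n. nderiv i f x / fact i * of_real (y - x) ^ i)) \<longlonglongrightarrow> 0"
        by (rule Lim_null_comparison[rotated]) (use rem in auto)
      have "(\<lambda>n. \<Sum>i\<le>n. nderiv i f x / fact i * of_real (y - x) ^ i) \<longlonglongrightarrow> f y"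
        using tendsto_diff[OF tendsto_const[of "f y"] lim] by simp
      then show ?thesis by (simp only: sums_def_le)
    qed
    moreover have "0 < r" using x \<rho> by (simp add: r_def)
    ultimately show "\<exists>r>0. \<exists>a. \<forall>y. \<bar>y - x\<bar> < r \<longrightarrow> (\<lambda>n. a n * of_real (y - x) ^ n) sums f y"
      by (intro exI[of _ r] conjI exI[of _ "\<lambda>n. nderiv n f x / fact n"] allI impI)
  qed
  then show "G \<in> analytic_germs"
    unfolding analytic_germs_def germs_at_0_def G using k by (intro UN_I[of "2 * k"]) auto
qed

section \<open>Growth conditions equivalent to strict inclusion\<close>

text \<open>The function \<open>1 / (1 - x)\<close> is the test germ: its derivatives at 0 turn an
  inclusion of germs into a lower bound for the weights.\<close>

lemma geometric_series_germ:
  obtains f where "germ_of f \<in> analytic_germs" "\<And>j. nderiv j f 0 = fact j"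
proof
  define f :: "real \<Rightarrow> complex" where "f x = of_real (1 / (1 - x))" for x
  have "f \<in> real_analytic_functions {- (1 / real 1)<..<1 / real 1}"
    unfolding real_analytic_functions_def
  proof (intro CollectI ballI)
    fix x assume "x \<in> {- (1 / real 1)<..<1 / real 1}"
    then have x: "x < 1" by simp
    have "(\<lambda>n. of_real (1 / (1 - x) ^ Suc n) * of_real (y - x) ^ n) sums f y" if "\<bar>y - x\<bar> < 1 - x" for y
    proof -
      have "norm ((y - x) / (1 - x)) < 1" using that x by simp
      from sums_mult[OF geometric_sums[OF this], of "1 / (1 - x)"]
      have "(\<lambda>n. 1 / (1 - x) ^ Suc n * (y - x) ^ n) sums (1 / (1 - x) * (1 / (1 - (y - x) / (1 - x))))"
        by (simp add: power_divide)
      also have "1 / (1 - x) * (1 / (1 - (y - x) / (1 - x))) = 1 / (1 - y)"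
        using x that by (simp add: field_simps)
      finally have "(\<lambda>n. of_real (1 / (1 - x) ^ Suc n * (y - x) ^ n) :: complex) sums of_real (1 / (1 - y))"
        by (rule sums_of_real)
      then show ?thesis by (simp add: f_def)
    qed
    then show "\<exists>r>0. \<exists>a. \<forall>y. \<bar>y - x\<bar> < r \<longrightarrow> (\<lambda>n. a n * of_real (y - x) ^ n) sums f y"
      using x by (intro exI[of _ "1 - x"] conjI exI[of _ "\<lambda>n. of_real (1 / (1 - x) ^ Suc n)"]) auto
  qed
  then show "germ_of f \<in> analytic_germs" unfolding analytic_germs_def germs_at_0_def by blast
  define g :: "nat \<Rightarrow> real \<Rightarrow> complex" where "g j x = of_real (fact j / (1 - x) ^ Suc j)" for j x
  have "nderiv j f 0 = g j 0" for j
  proof (rule nderiv_unique(1)[of "{..<1}"])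
    show "f x = g 0 x" for x by (simp add: f_def g_def)
    fix j and x :: real assume "x \<in> {..<1}"
    then have "((\<lambda>x. 1 / (1 - x)) has_real_derivative 1 / (1 - x)\<^sup>2) (at x)"
      by (auto intro!: derivative_eq_intros simp: power2_eq_square)
    from DERIV_cmult[OF DERIV_power[OF this, of "Suc j"], of "fact j"]
    have "((\<lambda>x. fact j / (1 - x) ^ Suc j) has_real_derivative fact (Suc j) / (1 - x) ^ Suc (Suc j)) (at x)"
      by (simp add: power_divide power2_eq_square mult_ac)
    then show "(g j has_vector_derivative g (Suc j) x) (at x)"
      unfolding g_def[abs_def] by (intro has_vector_derivative_of_real)
        (simp add: has_real_derivative_iff_has_vector_derivative)
  qed auto
  then show "nderiv j f 0 = fact j" for j by (simp add: g_def)
qed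

text \<open>The Beurling bound for the geometric series, read off on the compact set
  \<open>{0}\<close>.\<close>

lemma analytic_subset_beurlingD:
  assumes N: "\<And>j. 0 < N j" and sub: "analytic_germs \<subseteq> beurling_germs N" and h: "0 < h"
  obtains C where "0 < C" "\<And>j. fact j \<le> C * (h ^ j * N j)"
proof -
  obtain f where f: "germ_of f \<in> analytic_germs" "\<And>j. nderiv j f 0 = fact j"
    by (rule geometric_series_germ) blast
  then obtain k :: nat and g where k: "k \<ge> 1" and fg: "germ_eq f g"
    and g: "g \<in> beurling_functions N {- (1 / real k)<..<1 / real k}"
    using sub by (auto simp: beurling_germs_def germs_at_0_def germ_of_eq_iff)
  obtain e where e: "0 < e" "\<And>x. \<bar>x\<bar> < e \<Longrightarrow> f x = g x" by (rule germ_eqE[OF fg]) blast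
  have eq: "nderiv j f 0 = nderiv j g 0" for j
    by (rule nderiv_cong_open[of "ball 0 e"]) (use e in auto)
  have "ultradiff_bound N {0} h g" using g k h by (auto simp: beurling_functions_def)
  then obtain C where "\<And>j. norm (nderiv j g 0) \<le> C * (h ^ j * N j)"
    using ultradiff_bound_iff[OF h N] by auto
  then have C: "fact j \<le> C * (h ^ j * N j)" for j using f(2) eq by (metis norm_fact)
  have "0 < C * N 0" using C[of 0] by simp
  then have "0 < C" using N[of 0] zero_less_mult_pos2 by blast
  then show thesis using that C by blast
qed

lemma filterlim_root_over_fact_iff:
  assumes pos: "\<And>j. 0 < N j"
  shows "filterlim (\<lambda>j. root j (over_fact N j)) at_top sequentially \<longleftrightarrow>
    (\<forall>\<delta>>0. \<exists>c>0. \<forall>j. c * \<delta> ^ j * fact j \<le> N j)" (is "?lim \<longleftrightarrow> ?low")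
proof
  assume ?lim
  then have "\<forall>\<^sub>F j in sequentially. \<delta> \<le> root j (over_fact N j)" for \<delta>
    by (simp add: filterlim_at_top)
  then show ?low by (intro allI impI eventually_root_lower_bound[OF pos])
next
  assume low: ?low
  have "\<forall>\<^sub>F j in sequentially. Z \<le> root j (over_fact N j)" if Z: "0 < Z" for Z
  proof -
    \<comment> \<open>Doubling \<open>Z\<close> provides a factor \<open>2 ^ j\<close> that
      eventually absorbs \<open>c\<close>.\<close>
    obtain c where c: "0 < c" "\<And>j. c * (2 * Z) ^ j * fact j \<le> N j" using low[rule_format, of "2 * Z"] Z by auto
    obtain J :: nat where J: "1 / c \<le> real J" using real_arch_simple by blast
    have "Z \<le> root j (over_fact N j)" if j: "j \<ge> Suc J" for j
    proof -
      have "1 / c \<le> real j" using J j by simp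
      also have "\<dots> \<le> 2 ^ j" by simp
      finally have "1 * Z ^ j \<le> (c * 2 ^ j) * Z ^ j" using c Z by (intro mult_right_mono) (auto simp: field_simps)
      also have "\<dots> \<le> over_fact N j"
        using c(2)[of j] by (simp add: over_fact_def field_simps)
      finally have "root j (Z ^ j) \<le> root j (over_fact N j)" using j by (intro real_root_le_mono) auto
      then show ?thesis using j Z by (simp add: real_root_power_cancel)
    qed
    then show ?thesis by (auto simp: eventually_sequentially)
  qed
  then show ?lim by (subst filterlim_at_top_gt[of _ _ 0]) auto
qed

lemma filterlim_root_unbounded:
  assumes pos: "\<And>j. 0 < N j" and lim: "filterlim (\<lambda>j. root j (over_fact N j)) at_top sequentially"
  shows "\<exists>j\<ge>m. B ^ j \<le> over_fact N j"
proof -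
  obtain J where J: "\<And>j. j \<ge> J \<Longrightarrow> \<bar>B\<bar> \<le> root j (over_fact N j)"
    using lim by (auto simp: filterlim_at_top eventually_sequentially)
  define j where "j = Suc (max m J)"
  have "B ^ j \<le> \<bar>B\<bar> ^ j" by (simp flip: power_abs)
  also have "\<dots> \<le> root j (over_fact N j) ^ j" by (intro power_mono J) (auto simp: j_def)
  also have "\<dots> = over_fact N j" using pos[of j] by (simp add: j_def over_fact_def del: power_Suc)
  finally show ?thesis by (intro exI[of _ j]) (simp add: j_def)
qed

lemma SUP_root_unbounded:
  assumes pos: "\<And>j. 0 < N j" and sup: "(SUP j\<in>{0<..}. ereal (root j (over_fact N j))) = \<infinity>"
  shows "\<exists>j\<ge>m. B ^ j \<le> over_fact N j"
proof -
  \<comment> \<open>Including the roots up to \<open>m\<close> forces any index whose root exceeds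
    \<open>R\<close> beyond \<open>m\<close>; the absolute value takes care of negative
    \<open>B\<close>.\<close>
  define R where "R = Max (insert \<bar>B\<bar> ((\<lambda>j. root j (over_fact N j)) ` {..m}))"
  have "ereal R < (SUP j\<in>{0<..}. ereal (root j (over_fact N j)))" using sup by simp
  then obtain j where j: "0 < j" "R < root j (over_fact N j)" by (auto simp: less_SUP_iff)
  have "m < j"
  proof (rule ccontr)
    assume "\<not> m < j"
    then have "root j (over_fact N j) \<le> R" unfolding R_def by (intro Max_ge) auto
    then show False using j by simp
  qed
  have "\<bar>B\<bar> \<le> R" unfolding R_def by (intro Max_ge) auto
  have "B ^ j \<le> \<bar>B\<bar> ^ j" by (simp flip: power_abs)
  also have "\<dots> \<le> root j (over_fact N j) ^ j" using j \<open>\<bar>B\<bar> \<le> R\<close> by (intro power_mono) auto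
  also have "\<dots> = over_fact N j" using pos[of j] j by (simp add: over_fact_def)
  finally show ?thesis using \<open>m < j\<close> by (intro exI[of _ j]) simp
qed

lemma SUP_root_bounded:
  assumes N: "weight_sequence N" and sup: "(SUP j\<in>{0<..}. ereal (root j (over_fact N j))) \<noteq> \<infinity>"
  obtains H where "0 < H" "\<And>j. N j \<le> H ^ j * fact j"
proof -
  have "\<exists>n::nat. \<forall>j\<in>{0<..}. \<not> ereal (real n) \<le> ereal (root j (over_fact N j))"
    using sup SUP_PInfty[of "{0<..}" "\<lambda>j. ereal (root j (over_fact N j))"] by blast
  then obtain n :: nat where n: "\<And>j. 0 < j \<Longrightarrow> root j (over_fact N j) < real n" by (auto simp: not_le)
  show thesis
  proof
    show "0 < real (Suc n)" by simp
    fix j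
    show "N j \<le> real (Suc n) ^ j * fact j"
    proof (cases "j = 0")
      case True then show ?thesis using weight_sequence_0[OF N] by simp
    next
      case False
      have p: "0 < over_fact N j" using weight_sequence_pos[OF N] by (simp add: over_fact_def)
      have "over_fact N j = root j (over_fact N j) ^ j" using False p by simp
      also have "\<dots> \<le> real (Suc n) ^ j"
        using n[of j] False p by (intro power_mono) (auto simp: less_imp_le)
      finally show ?thesis by (simp add: over_fact_def field_simps del: of_nat_Suc)
    qed
  qed
qed

text \<open>Forward, the geometric series with \<open>h = 1 / \<delta>\<close> gives the lower bound
  at every \<open>\<delta>\<close>. Backward, these lower bounds give the inclusion and the sum of
  exponentials its strictness.\<close>

lemma analytic_germs_psubset_beurling_iff:
  assumes N: "weight_sequence N"
  shows "analytic_germs \<subset> beurling_germs N \<longleftrightarrow>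
    filterlim (\<lambda>j. root j (over_fact N j)) at_top sequentially"
proof
  note pos = weight_sequence_pos[OF N]
  assume sub: "analytic_germs \<subset> beurling_germs N"
  show "filterlim (\<lambda>j. root j (over_fact N j)) at_top sequentially"
    unfolding filterlim_root_over_fact_iff[OF pos]
  proof (intro allI impI)
    fix \<delta> :: real assume \<delta>: "0 < \<delta>"
    obtain C where C: "0 < C" "\<And>j. fact j \<le> C * ((1 / \<delta>) ^ j * N j)"
      by (rule analytic_subset_beurlingD[OF pos, where h = "1 / \<delta>"]) (use sub \<delta> in auto)
    have "1 / C * \<delta> ^ j * fact j \<le> N j" for j
      using C \<delta> by (simp add: power_divide field_simps)
    then show "\<exists>c>0. \<forall>j. c * \<delta> ^ j * fact j \<le> N j" using C(1) by (intro exI[of _ "1 / C"]) simp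
  qed
next
  note pos = weight_sequence_pos[OF N]
  assume lim: "filterlim (\<lambda>j. root j (over_fact N j)) at_top sequentially"
  then have "analytic_germs \<subseteq> beurling_germs N"
    using filterlim_root_over_fact_iff[OF pos] by (intro analytic_germs_subset_beurling pos) auto
  moreover obtain G where "G \<in> beurling_germs N" "G \<notin> analytic_germs"
    by (rule nonanalytic_beurling_germ[OF N filterlim_root_unbounded[OF pos lim]])
  ultimately show "analytic_germs \<subset> beurling_germs N" by blast
qed

text \<open>If the roots are bounded, then \<open>N j \<le> H ^ j * fact j\<close> and every Roumieu
  germ is analytic. Conversely, the positive lower limit of the roots gives the inclusion, and a
  nonanalytic Beurling germ its strictness.\<close>

lemma analytic_germs_psubset_roumieu_iff:
  assumes N: "weight_sequence N"
  shows "analytic_germs \<subset> roumieu_germs N \<longleftrightarrow>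
    (SUP j\<in>{0<..}. ereal (root j (over_fact N j))) = \<infinity>"
proof
  note pos = weight_sequence_pos[OF N]
  assume sub: "analytic_germs \<subset> roumieu_germs N"
  show "(SUP j\<in>{0<..}. ereal (root j (over_fact N j))) = \<infinity>"
  proof (rule ccontr)
    assume "(SUP j\<in>{0<..}. ereal (root j (over_fact N j))) \<noteq> \<infinity>"
    then obtain H where "0 < H" "\<And>j. N j \<le> H ^ j * fact j" by (rule SUP_root_bounded[OF N]) blast
    from roumieu_germs_subset_analytic[OF pos this] show False using sub by blast
  qed
next
  note pos = weight_sequence_pos[OF N]
  assume sup: "(SUP j\<in>{0<..}. ereal (root j (over_fact N j))) = \<infinity>"
  obtain c \<delta> where "0 < c" "0 < \<delta>" "\<And>j. c * \<delta> ^ j * fact j \<le> N j"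
    by (rule weight_sequence_lower_bound[OF N]) blast
  from analytic_germs_subset_roumieu[OF pos this] have "analytic_germs \<subseteq> roumieu_germs N" .
  moreover obtain G where "G \<in> beurling_germs N" "G \<notin> analytic_germs"
    by (rule nonanalytic_beurling_germ[OF N SUP_root_unbounded[OF pos sup]])
  ultimately show "analytic_germs \<subset> roumieu_germs N"
    using beurling_germs_subset_roumieu_germs by blast
qed

theorem theorem3p2:
  fixes M N :: "nat \<Rightarrow> real"
  assumes "weight_sequence M" and "quasianalytic M"
    and "weight_sequence N" and "quasianalytic N"
  shows
    "((analytic_germs \<subset> beurling_germs N \<longleftrightarrow>
         filterlim (\<lambda>j. root j (over_fact N j)) at_top sequentially) \<and>
      (analytic_germs \<subset> beurling_germs N \<longrightarrow>
         algebrable (UNIV :: real set) (beurling_series N)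
           (beurling_series N - borel_map ` roumieu_germs M) \<and>
         algebrable (UNIV :: real set) (beurling_series N)
           (beurling_series N - borel_map ` beurling_germs M))) \<and>
     ((analytic_germs \<subset> roumieu_germs N \<longleftrightarrow>
         (SUP j\<in>{0<..}. ereal (root j (over_fact N j))) = \<infinity>) \<and>
      (analytic_germs \<subset> roumieu_germs N \<longrightarrow>
         algebrable (UNIV :: real set) (roumieu_series N)
           (roumieu_series N - borel_map ` roumieu_germs M) \<and>
         algebrable (UNIV :: real set) (roumieu_series N)
           (roumieu_series N - borel_map ` beurling_germs M)))"
proof (intro conjI impI)
  note N = assms(3)
  note pos = weight_sequence_pos[OF N]
  show "analytic_germs \<subset> beurling_germs N \<longleftrightarrow>
      filterlim (\<lambda>j. root j (over_fact N j)) at_top sequentially"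
    by (rule analytic_germs_psubset_beurling_iff[OF N])
  show "analytic_germs \<subset> roumieu_germs N \<longleftrightarrow>
      (SUP j\<in>{0<..}. ereal (root j (over_fact N j))) = \<infinity>"
    by (rule analytic_germs_psubset_roumieu_iff[OF N])
  have images: "borel_map ` beurling_germs M \<subseteq> borel_map ` roumieu_germs M"
    by (intro image_mono beurling_germs_subset_roumieu_germs)
  {
    assume "analytic_germs \<subset> beurling_germs N"
    then have "filterlim (\<lambda>j. root j (over_fact N j)) at_top sequentially"
      by (simp add: analytic_germs_psubset_beurling_iff[OF N])
    note unb = filterlim_root_unbounded[OF pos this]
    show "algebrable (UNIV :: real set) (beurling_series N) (beurling_series N - borel_map ` roumieu_germs M)"
      by (rule algebrable_complement[OF assms(1-3) unb order_refl order_refl])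
    show "algebrable (UNIV :: real set) (beurling_series N) (beurling_series N - borel_map ` beurling_germs M)"
      by (rule algebrable_complement[OF assms(1-3) unb order_refl images])
  }
  {
    assume "analytic_germs \<subset> roumieu_germs N"
    then have "(SUP j\<in>{0<..}. ereal (root j (over_fact N j))) = \<infinity>"
      by (simp add: analytic_germs_psubset_roumieu_iff[OF N])
    note unb = SUP_root_unbounded[OF pos this]
    show "algebrable (UNIV :: real set) (roumieu_series N) (roumieu_series N - borel_map ` roumieu_germs M)"
      by (rule algebrable_complement[OF assms(1-3) unb beurling_series_subset_roumieu_series order_refl])
    show "algebrable (UNIV :: real set) (roumieu_series N) (roumieu_series N - borel_map ` beurling_germs M)"
      by (rule algebrable_complement[OF assms(1-3) unb beurling_series_subset_roumieu_series images])
  }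
qed

end
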